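(* Let $T$ be an isotropic spherical random field with harmonic coefficients $\{a_{\ell m}\}$ and angular power spectrum $\{C_\ell\}$, and let $H\in L^2(\mathbb{S}^2)$ be a real-valued kernel $H(\mathbf{x})=\sum_{\ell\in\mathbb{N}_0}\sum_{m=-\ell}^{\ell}h_{\ell m}Y_{\ell m}(\mathbf{x})$. Then the sifting convolution $T_\circledast(\mathbf{x})=\int_{\mathbb{S}^2}(\mathcal{L}_{\mathbf{x}}T)(\mathbf{x}')H(\mathbf{x}')\,d\mathbf{s}(\mathbf{x}')$ has the spectral representation $$T_\circledast(\mathbf{x})=\sum_{\ell\in\mathbb{N}_0}\sum_{m=-\ell}^{\ell}a_{\ell m,\circledast}Y_{\ell m}(\mathbf{x}),\qquad a_{\ell m,\circledast}=a_{\ell m}h^*_{\ell m}.$$ Thus $\mathbf{E}a_{\ell m,\circledast}=0$ and $\mathbf{E}(a_{\ell m,\circledast}a^*_{\ell'm',\circledast})=C_{\ell m,\circledast}\delta_\ell^{\ell'}\delta_m^{m'}$, where $C_{\ell m,\circledast}=C_\ell|h_{\ell m}|^2$. The field $T_\circledast$ is zero-mean, and its covariance function is $$\mathrm{Cov}(T_\circledast(\mathbf{x}_1),T_\circledast(\mathbf{x}_2))=\sum_{\ell\in\mathbb{N}_0}C_\ell\sum_{m=-\ell}^{\ell}|h_{\ell m}|^2Y_{\ell m}(\mathbf{x}_1)Y^*_{\ell m}(\mathbf{x}_2),\quad\mathbf{x}_1,\mathbf{x}_2\in\mathbb{S}^2.$$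
   Context: $T$ is a real-valued zero-mean second-order random field on the unit sphere $\mathbb{S}^2\subset\mathbb{R}^3$ with continuous, not identically constant covariance; isotropic means that the covariance depends only on the great-circle distance. $d\mathbf{s}$ is the surface measure, $*$ is complex conjugation, and $Y_{\ell m}$ are the standard complex orthonormal spherical harmonics with $Y_{\ell(-m)}=(-1)^mY^*_{\ell m}$. $T=\sum_\ell\sum_m a_{\ell m}Y_{\ell m}$ (in mean square) with $a_{\ell m}=\int_{\mathbb{S}^2}TY^*_{\ell m}\,d\mathbf{s}$, and $\mathbf{E}a_{\ell m}a^*_{\ell'm'}=\delta_\ell^{\ell'}\delta_m^{m'}C_\ell$. The spherical translation operator is $(\mathcal{L}_{\mathbf{x}}T)(\mathbf{x}')=\sum_{\ell\in\mathbb{N}_0}\sum_{m=-\ell}^{\ell}a_{\ell m}Y_{\ell m}(\mathbf{x})Y_{\ell m}(\mathbf{x}')$ (for fixed $\mathbf{x}$, a series in $L^2(\Omega\times\mathbb{S}^2)$ in the variable $\mathbf{x}'$). For zero-mean, possibly complex-valued fields, $\mathrm{Cov}(T_\circledast(\mathbf{x}_1),T_\circledast(\mathbf{x}_2))=\mathbf{E}(T_\circledast(\mathbf{x}_1)T_\circledast(\mathbf{x}_2)^* )$. *)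

theory Defs
  imports "HOL-Probability.Probability"
begin

abbreviation S2 :: "(real^3) set" where
  "S2 \<equiv> sphere 0 1"

definition sph_point :: "real \<Rightarrow> real \<Rightarrow> real^3" where
  "sph_point \<theta> \<phi> = vector [sin \<theta> * cos \<phi>, sin \<theta> * sin \<phi>, cos \<theta>]"

text \<open>The surface measure in spherical coordinates, with area element
  \<open>sin \<theta> d\<theta> d\<phi>\<close> for colatitude \<open>\<theta>\<close> and longitude \<open>\<phi>\<close>.\<close>

definition surface_measure :: "(real^3) measure" where
  "surface_measure =
     distr (density (restrict_space lborel ({0..pi} \<times> {-pi..pi})) (\<lambda>(\<theta>, \<phi>). ennreal (sin \<theta>)))
           (restrict_space borel S2) (\<lambda>(\<theta>, \<phi>). sph_point \<theta> \<phi>)"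

definition gc_dist :: "real^3 \<Rightarrow> real^3 \<Rightarrow> real" where
  "gc_dist x y = arccos (x \<bullet> y)"

text \<open>Rodrigues' formula.\<close>

definition legendre_poly :: "nat \<Rightarrow> real poly" where
  "legendre_poly l = smult (1 / (2 ^ l * fact l)) ((pderiv ^^ l) ([:-1, 0, 1:] ^ l))"

text \<open>The factor \<open>(-1) ^ m\<close> is the Condon--Shortley phase.\<close>

definition assoc_legendre :: "nat \<Rightarrow> nat \<Rightarrow> real \<Rightarrow> real" where
  "assoc_legendre l m t = (-1) ^ m * sqrt (1 - t\<^sup>2) ^ m * poly ((pderiv ^^ m) (legendre_poly l)) t"

definition Ylm_nonneg :: "nat \<Rightarrow> nat \<Rightarrow> real \<Rightarrow> real \<Rightarrow> complex" where
  "Ylm_nonneg l m \<theta> \<phi> =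
     complex_of_real (sqrt ((2 * real l + 1) / (4 * pi) * (fact (l - m) / fact (l + m)))
                      * assoc_legendre l m (cos \<theta>)) * cis (real m * \<phi>)"

definition Ylm_angles :: "nat \<Rightarrow> int \<Rightarrow> real \<Rightarrow> real \<Rightarrow> complex" where
  "Ylm_angles l m \<theta> \<phi> =
     (if m \<ge> 0 then Ylm_nonneg l (nat m) \<theta> \<phi>
      else (-1) ^ nat (- m) * cnj (Ylm_nonneg l (nat (- m)) \<theta> \<phi>))"

text \<open>At the poles the longitude is arbitrary; \<open>Ylm_angles l m\<close> does not depend on it there,
  because \<open>assoc_legendre l m\<close> vanishes at \<open>\<plusminus>1\<close> for \<open>m > 0\<close>.\<close>

definition Ylm :: "nat \<Rightarrow> int \<Rightarrow> real^3 \<Rightarrow> complex" where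
  "Ylm l m x = Ylm_angles l m (arccos (x $ 3)) (Arg (Complex (x $ 1) (x $ 2)))"

definition square_integrable :: "'a measure \<Rightarrow> ('a \<Rightarrow> complex) \<Rightarrow> bool" where
  "square_integrable N f \<longleftrightarrow> f \<in> borel_measurable N \<and> integrable N (\<lambda>z. (cmod (f z))\<^sup>2)"

definition L2_sums :: "'a measure \<Rightarrow> (nat \<Rightarrow> 'a \<Rightarrow> complex) \<Rightarrow> ('a \<Rightarrow> complex) \<Rightarrow> bool" where
  "L2_sums N f s \<longleftrightarrow>
     (\<forall>l. square_integrable N (f l)) \<and> square_integrable N s \<and>
     (\<lambda>n. \<integral>z. (cmod ((\<Sum>l<n. f l z) - s z))\<^sup>2 \<partial>N) \<longlonglongrightarrow> 0"

text \<open>The sum of a series in \<open>L\<^sup>2\<close> is unique up to equality almost everywhere;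
  this picks one representative.\<close>

definition L2_suminf :: "'a measure \<Rightarrow> (nat \<Rightarrow> 'a \<Rightarrow> complex) \<Rightarrow> 'a \<Rightarrow> complex" where
  "L2_suminf N f = (SOME s. L2_sums N f s)"

text \<open>Fields are functions on \<open>real^3\<close>, of which only the values on \<open>S2\<close> matter
  (\<open>surface_measure\<close> has space \<open>S2\<close>). Joint measurability makes the harmonic coefficients,
  which are integrals along sample paths, well-defined random variables.\<close>

definition second_order_field :: "'w measure \<Rightarrow> ('w \<Rightarrow> real^3 \<Rightarrow> real) \<Rightarrow> bool" where
  "second_order_field M T \<longleftrightarrow>
     prob_space M \<and>
     (\<lambda>(\<omega>, x). T \<omega> x) \<in> borel_measurable (M \<Otimes>\<^sub>M surface_measure) \<and>
     (\<forall>x\<in>S2. integrable M (\<lambda>\<omega>. (T \<omega> x)\<^sup>2))"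

definition zero_mean_field :: "'w measure \<Rightarrow> ('w \<Rightarrow> real^3 \<Rightarrow> real) \<Rightarrow> bool" where
  "zero_mean_field M T \<longleftrightarrow> (\<forall>x\<in>S2. (\<integral>\<omega>. T \<omega> x \<partial>M) = 0)"

text \<open>No means are subtracted, so this is the covariance only of fields with zero mean.\<close>

definition field_cov :: "'w measure \<Rightarrow> ('w \<Rightarrow> real^3 \<Rightarrow> complex) \<Rightarrow> real^3 \<Rightarrow> real^3 \<Rightarrow> complex" where
  "field_cov M U x y = (\<integral>\<omega>. U \<omega> x * cnj (U \<omega> y) \<partial>M)"

abbreviation real_field_cov :: "'w measure \<Rightarrow> ('w \<Rightarrow> real^3 \<Rightarrow> real) \<Rightarrow> real^3 \<Rightarrow> real^3 \<Rightarrow> complex"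
  where "real_field_cov M T \<equiv> field_cov M (\<lambda>\<omega> x. complex_of_real (T \<omega> x))"

definition isotropic_random_field :: "'w measure \<Rightarrow> ('w \<Rightarrow> real^3 \<Rightarrow> real) \<Rightarrow> bool" where
  "isotropic_random_field M T \<longleftrightarrow>
     second_order_field M T \<and> zero_mean_field M T \<and>
     continuous_on (S2 \<times> S2) (\<lambda>(x, y). real_field_cov M T x y) \<and>
     \<not> (\<lambda>(x, y). real_field_cov M T x y) constant_on (S2 \<times> S2) \<and>
     (\<exists>R. \<forall>x\<in>S2. \<forall>y\<in>S2. real_field_cov M T x y = R (gc_dist x y))"

definition harmonic_coeff :: "('w \<Rightarrow> real^3 \<Rightarrow> real) \<Rightarrow> nat \<Rightarrow> int \<Rightarrow> 'w \<Rightarrow> complex" where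
  "harmonic_coeff T l m \<omega> = (\<integral>x. complex_of_real (T \<omega> x) * cnj (Ylm l m x) \<partial>surface_measure)"

text \<open>For \<open>l = l'\<close> and \<open>m = m'\<close> this fixes \<open>C l\<close> as the common variance of the coefficients
  of degree \<open>l\<close>, so \<open>C\<close> is determined by \<open>T\<close>.\<close>

definition angular_power_spectrum ::
    "'w measure \<Rightarrow> ('w \<Rightarrow> real^3 \<Rightarrow> real) \<Rightarrow> (nat \<Rightarrow> real) \<Rightarrow> bool" where
  "angular_power_spectrum M T C \<longleftrightarrow>
     (\<forall>l l'. \<forall>m\<in>{-int l..int l}. \<forall>m'\<in>{-int l'..int l'}.
        (\<integral>\<omega>. harmonic_coeff T l m \<omega> * cnj (harmonic_coeff T l' m' \<omega>) \<partial>M) =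
        (if l = l' \<and> m = m' then complex_of_real (C l) else 0))"

definition translation_term ::
    "('w \<Rightarrow> real^3 \<Rightarrow> real) \<Rightarrow> real^3 \<Rightarrow> nat \<Rightarrow> 'w \<times> (real^3) \<Rightarrow> complex" where
  "translation_term T x l =
     (\<lambda>(\<omega>, x'). \<Sum>m=-int l..int l. harmonic_coeff T l m \<omega> * Ylm l m x * Ylm l m x')"

text \<open>For fixed \<open>x\<close> the series converges in \<open>L\<^sup>2\<close> of the product space, so the translated field, and
  with it \<open>sifting_convolution M T H\<close> at \<open>x\<close>, is determined up to almost sure equality.\<close>

definition spherical_translation ::
    "'w measure \<Rightarrow> ('w \<Rightarrow> real^3 \<Rightarrow> real) \<Rightarrow> real^3 \<Rightarrow> 'w \<times> (real^3) \<Rightarrow> complex" where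
  "spherical_translation M T x = L2_suminf (M \<Otimes>\<^sub>M surface_measure) (translation_term T x)"

definition sifting_convolution ::
    "'w measure \<Rightarrow> ('w \<Rightarrow> real^3 \<Rightarrow> real) \<Rightarrow> (real^3 \<Rightarrow> real) \<Rightarrow> 'w \<Rightarrow> real^3 \<Rightarrow> complex" where
  "sifting_convolution M T H \<omega> x =
     (\<integral>x'. spherical_translation M T x (\<omega>, x') * complex_of_real (H x') \<partial>surface_measure)"

definition sifting_coeff ::
    "('w \<Rightarrow> real^3 \<Rightarrow> real) \<Rightarrow> (nat \<Rightarrow> int \<Rightarrow> complex) \<Rightarrow> nat \<Rightarrow> int \<Rightarrow> 'w \<Rightarrow> complex" where
  "sifting_coeff T h l m \<omega> = harmonic_coeff T l m \<omega> * cnj (h l m)"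

definition sifting_spectrum ::
    "(nat \<Rightarrow> real) \<Rightarrow> (nat \<Rightarrow> int \<Rightarrow> complex) \<Rightarrow> nat \<Rightarrow> int \<Rightarrow> real" where
  "sifting_spectrum C h l m = C l * (cmod (h l m))\<^sup>2"

lemma sph_point_in_S2: "sph_point \<theta> \<phi> \<in> S2"
proof -
  have "(norm (sph_point \<theta> \<phi>))\<^sup>2 = (sin \<theta>)\<^sup>2 * ((cos \<phi>)\<^sup>2 + (sin \<phi>)\<^sup>2) + (cos \<theta>)\<^sup>2"
    unfolding power2_norm_eq_inner sph_point_def distrib_left
    by (simp add: inner_vec_def sum_3 power2_eq_square ac_simps)
  then have "(norm (sph_point \<theta> \<phi>))\<^sup>2 = 1"
    by (simp only: sin_cos_squared_add2 sin_cos_squared_add mult_1_right)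
  then show ?thesis by (simp add: power2_eq_1_iff) (smt (verit) norm_ge_zero)
qed

lemma measurable_sph_point:
  "(\<lambda>(\<theta>, \<phi>). sph_point \<theta> \<phi>) \<in> borel \<rightarrow>\<^sub>M restrict_space borel S2"
proof (rule measurable_restrict_space2)
  have "continuous_on UNIV (\<lambda>p::real \<times> real. sph_point (fst p) (snd p))"
    unfolding sph_point_def continuous_on_def
  proof (intro ballI vec_tendstoI)
    fix p :: "real \<times> real" and i :: 3
    show "((\<lambda>p. vector [sin (fst p) * cos (snd p), sin (fst p) * sin (snd p), cos (fst p)] $ i)
            \<longlongrightarrow> (vector [sin (fst p) * cos (snd p), sin (fst p) * sin (snd p), cos (fst p)] :: real^3) $ i) (at p within UNIV)"
      using exhaust_3[of i] by (elim disjE; simp; intro tendsto_intros)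
  qed
  then show "(\<lambda>(\<theta>, \<phi>). sph_point \<theta> \<phi>) \<in> borel \<rightarrow>\<^sub>M borel"
    by (intro borel_measurable_continuous_onI) (simp add: case_prod_beta')
qed (use sph_point_in_S2 in auto)

lemma sets_surface_measure: "sets surface_measure = sets (restrict_space borel S2)"
  by (simp add: surface_measure_def)

lemma space_surface_measure: "space surface_measure = S2"
  by (simp add: surface_measure_def space_restrict_space)

lemma emeasure_surface_measure: "emeasure surface_measure S2 = ennreal (4 * pi)"
proof -
  let ?B = "{0..pi} \<times> {-pi..pi} :: (real \<times> real) set"
  let ?R = "restrict_space lborel ?B"
  have B: "?B \<in> sets lborel" 
    by (simp add: borel_closed closed_Times)
  have m1: "(\<lambda>(\<theta>, \<phi>). sph_point \<theta> \<phi>) \<in> ?R \<rightarrow>\<^sub>M restrict_space borel S2"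
    by (rule measurable_restrict_space1) (use measurable_sph_point in simp)
  have m2: "(\<lambda>(\<theta>, \<phi>). ennreal (sin \<theta>)) \<in> borel_measurable (borel :: (real \<times> real) measure)"
    unfolding case_prod_beta' borel_prod[symmetric] by measurable
  have s: "sin x \<ge> 0" if "x \<in> {0..pi}" for x using that by (simp add: sin_ge_zero)
  have "emeasure surface_measure S2 = (\<integral>\<^sup>+ p. (case p of (\<theta>, \<phi>) \<Rightarrow> ennreal (sin \<theta>)) \<partial>?R)"
  proof -
    have "S2 \<in> sets (restrict_space borel S2)"
      using sets.top[of "restrict_space borel S2"] by (simp add: space_restrict_space)
    moreover have "(\<lambda>(\<theta>, \<phi>). sph_point \<theta> \<phi>) -` S2 = UNIV" using sph_point_in_S2 by auto
    moreover have "(\<lambda>(\<theta>, \<phi>). ennreal (sin \<theta>)) \<in> borel_measurable ?R"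
      by (rule measurable_restrict_space1) (use m2 in simp)
    ultimately show ?thesis
      unfolding surface_measure_def using m1
      by (subst emeasure_distr) (auto simp: emeasure_density intro!: nn_integral_cong)
  qed
  also have "\<dots> = (\<integral>\<^sup>+ p. ennreal (sin (fst p)) * indicator ?B p \<partial>lborel)"
    using B by (subst nn_integral_restrict_space) (auto simp: case_prod_beta')
  also have "\<dots> = (\<integral>\<^sup>+ p. (ennreal (sin (fst p)) * indicator {0..pi} (fst p)) * indicator {-pi..pi} (snd p) \<partial>(lborel \<Otimes>\<^sub>M lborel))"
    unfolding lborel_prod by (intro nn_integral_cong) (auto simp: indicator_def)
  also have "\<dots> = (\<integral>\<^sup>+ x. \<integral>\<^sup>+ y. (ennreal (sin x) * indicator {0..pi} x) * indicator {-pi..pi} y \<partial>lborel \<partial>lborel)"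
    by (subst lborel.nn_integral_fst[symmetric]) auto
  also have "\<dots> = (\<integral>\<^sup>+ x. (ennreal (sin x) * indicator {0..pi} x) * ennreal (2 * pi) \<partial>lborel)"
    by (subst nn_integral_cmult) auto
  also have "\<dots> = (\<integral>\<^sup>+ x. ennreal (sin x) * indicator {0..pi} x \<partial>lborel) * ennreal (2 * pi)"
    by (rule nn_integral_multc) auto
  also have "(\<integral>\<^sup>+ x. ennreal (sin x) * indicator {0..pi} x \<partial>lborel) = ennreal ((- cos pi) - (- cos 0))"
    by (rule nn_integral_FTC_Icc) (auto intro!: derivative_eq_intros s)
  also have "\<dots> * ennreal (2 * pi) = ennreal (4 * pi)"
    by (simp add: ennreal_mult' flip: ennreal_numeral) (simp flip: ennreal_mult' ennreal_numeral)
  finally show ?thesis .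
qed

lemma Ylm_uminus:
  assumes "m \<ge> 0"
  shows "Ylm l (- m) x = (-1) ^ nat m * cnj (Ylm l m x)"
  using assms by (cases "m = 0") (auto simp: Ylm_def Ylm_angles_def Ylm_nonneg_def)

lemma Ylm_sph_point:
  assumes "\<theta> \<in> {0..pi}" "\<phi> \<in> {-pi<..pi}"
  shows "Ylm l m (sph_point \<theta> \<phi>) = Ylm_angles l m \<theta> \<phi>"
proof -
  have th: "arccos (cos \<theta>) = \<theta>" using assms by (intro arccos_cos) auto
  have c: "Complex (sin \<theta> * cos \<phi>) (sin \<theta> * sin \<phi>) = of_real (sin \<theta>) * exp (\<i> * of_real \<phi>)"
    by (simp add: complex_eq_iff Re_exp Im_exp)
  show ?thesis
  proof (cases "sin \<theta> = 0")
    case False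
    then have "sin \<theta> > 0" using assms sin_ge_zero[of \<theta>] by auto
    then have "Arg (Complex (sin \<theta> * cos \<phi>) (sin \<theta> * sin \<phi>)) = \<phi>"
      unfolding c using assms by (intro Arg_unique[of "sin \<theta>"]) auto
    then show ?thesis by (simp add: Ylm_def sph_point_def th)
  next
    case True
    have z: "assoc_legendre l k (cos \<theta>) = 0" if "k > 0" for k
      using True that by (simp add: assoc_legendre_def flip: sin_squared_eq)
    have "Ylm_nonneg l k \<theta> a = Ylm_nonneg l k \<theta> b" for k a b
      by (cases "k = 0") (simp_all add: Ylm_nonneg_def z)
    then show ?thesis
      by (simp add: Ylm_def sph_point_def th Ylm_angles_def)
  qed
qed

end

theory Submission
  imports Defs
begin

text \<open>
  Isotropy makes the variance of the field constant on the sphere, so the field lies in \<open>L\<^sup>2\<close> of the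
  product of the probability space and the sphere, and Bessel's inequality gives summability of
  \<open>C l * (2 * l + 1)\<close>. The degree-\<open>l\<close> terms of the translated field at \<open>x\<close> are orthogonal in that
  space, and their squared norm is \<open>C l\<close> times the sum of \<open>\<bar>Y l m x\<bar>\<^sup>2\<close> over \<open>m\<close>. By the addition theorem
  on the diagonal this sum is \<open>(2 * l + 1) / (4 * pi)\<close> at every point \<open>x\<close>, so the series converges by
  completeness. Integrating against the kernel is continuous from \<open>L\<^sup>2\<close> of the product
  to \<open>L\<^sup>2\<close> of the probability space, so it can be done term by term, and orthonormality of the
  harmonics turns the integral of \<open>Y l m * H\<close> into the conjugate of \<open>h l m\<close>. Mean and covariance follow
  from continuity of the inner product.
\<close>

section \<open>Square integrable functions\<close>

lemma square_integrable_cnj: "square_integrable N f \<Longrightarrow> square_integrable N (\<lambda>x. cnj (f x))"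
  unfolding square_integrable_def
  by (auto intro: measurable_compose[OF _ borel_measurable_continuous_onI] continuous_intros)

lemma square_integrable_cmult: "square_integrable N f \<Longrightarrow> square_integrable N (\<lambda>x. c * f x)"
  unfolding square_integrable_def by (auto simp: norm_mult power_mult_distrib)

lemma square_integrable_zero: "square_integrable N (\<lambda>x. 0)"
  unfolding square_integrable_def by simp

lemma square_integrable_bound:
  assumes "integrable N g" "f \<in> borel_measurable N" "AE x in N. (cmod (f x))\<^sup>2 \<le> g x"
  shows "square_integrable N f"
  unfolding square_integrable_def
proof
  show "integrable N (\<lambda>x. (cmod (f x))\<^sup>2)"
    using assms(2,3) by (intro Bochner_Integration.integrable_bound[OF assms(1)]) auto
qed fact

lemma cmod_add_squared_le: "(cmod (a + b))\<^sup>2 \<le> 2 * (cmod a)\<^sup>2 + 2 * (cmod b)\<^sup>2"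
proof -
  have "(cmod (a + b))\<^sup>2 \<le> (cmod a + cmod b)\<^sup>2"
    by (intro power_mono norm_triangle_ineq) auto
  also have "\<dots> \<le> 2 * (cmod a)\<^sup>2 + 2 * (cmod b)\<^sup>2"
    using zero_le_power2[of "cmod a - cmod b"] by (simp add: power2_eq_square algebra_simps)
  finally show ?thesis .
qed

lemma square_integrable_add:
  assumes "square_integrable N f" "square_integrable N g"
  shows "square_integrable N (\<lambda>x. f x + g x)"
  using assms cmod_add_squared_le
  by (intro square_integrable_bound[of N "\<lambda>x. 2 * (cmod (f x))\<^sup>2 + 2 * (cmod (g x))\<^sup>2"])
     (auto simp: square_integrable_def)

lemma square_integrable_diff:
  assumes "square_integrable N f" "square_integrable N g"
  shows "square_integrable N (\<lambda>x. f x - g x)"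
  using square_integrable_add[OF assms(1) square_integrable_cmult[OF assms(2), of "-1"]] by simp

lemma square_integrable_sum:
  assumes "\<And>i. i \<in> I \<Longrightarrow> square_integrable N (f i)"
  shows "square_integrable N (\<lambda>x. \<Sum>i\<in>I. f i x)"
  using assms
  by (induction I rule: infinite_finite_induct)
     (auto intro: square_integrable_zero square_integrable_add)

lemma integrable_mult_square_integrable:
  assumes "square_integrable N f" "square_integrable N g"
  shows "integrable N (\<lambda>x. f x * g x)"
proof (rule Bochner_Integration.integrable_bound[of N "\<lambda>x. (cmod (f x))\<^sup>2 + (cmod (g x))\<^sup>2"])
  show "AE x in N. cmod (f x * g x) \<le> norm ((cmod (f x))\<^sup>2 + (cmod (g x))\<^sup>2)"
  proof (rule AE_I2)
    fix x
    have "0 \<le> (cmod (f x) - cmod (g x))\<^sup>2 + (cmod (f x))\<^sup>2 + (cmod (g x))\<^sup>2" by simp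
    then show "cmod (f x * g x) \<le> norm ((cmod (f x))\<^sup>2 + (cmod (g x))\<^sup>2)"
      by (simp add: norm_mult power2_eq_square algebra_simps)
  qed
qed (use assms in \<open>auto simp: square_integrable_def\<close>)

text \<open>The inequality is taken from the nonnegative extended reals, where no integrability is
  at issue. Without conjugation it serves both integration against a kernel and, through
  \<open>cnj\<close>, inner products.\<close>

lemma Cauchy_Schwarz_square_integrable:
  assumes "square_integrable N f" "square_integrable N g"
  shows "(cmod (\<integral>x. f x * g x \<partial>N))\<^sup>2 \<le> (\<integral>x. (cmod (f x))\<^sup>2 \<partial>N) * (\<integral>x. (cmod (g x))\<^sup>2 \<partial>N)"
proof -
  have [measurable]: "f \<in> borel_measurable N" "g \<in> borel_measurable N"
    using assms by (auto simp: square_integrable_def)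
  have nn: "(\<integral>\<^sup>+x. (ennreal (cmod (h x)))\<^sup>2 \<partial>N) = ennreal (\<integral>x. (cmod (h x))\<^sup>2 \<partial>N)"
    if "square_integrable N h" for h
    using that unfolding square_integrable_def
    by (subst nn_integral_eq_integral[symmetric]) (auto simp: ennreal_power)
  have "ennreal ((cmod (\<integral>x. f x * g x \<partial>N))\<^sup>2) = (ennreal (cmod (\<integral>x. f x * g x \<partial>N)))\<^sup>2"
    by (simp add: ennreal_power)
  also have "\<dots> \<le> (\<integral>\<^sup>+x. ennreal (cmod (f x)) * ennreal (cmod (g x)) \<partial>N)\<^sup>2"
    using integral_norm_bound_ennreal[OF integrable_mult_square_integrable[OF assms]]
    by (intro power_mono) (simp_all add: norm_mult ennreal_mult)
  also have "\<dots> \<le> (\<integral>\<^sup>+x. (ennreal (cmod (f x)))\<^sup>2 \<partial>N) * (\<integral>\<^sup>+x. (ennreal (cmod (g x)))\<^sup>2 \<partial>N)"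
    by (rule Cauchy_Schwarz_nn_integral) auto
  also have "\<dots> = ennreal ((\<integral>x. (cmod (f x))\<^sup>2 \<partial>N) * (\<integral>x. (cmod (g x))\<^sup>2 \<partial>N))"
    unfolding nn[OF assms(1)] nn[OF assms(2)] by (simp add: ennreal_mult)
  finally show ?thesis by (simp add: ennreal_le_iff)
qed

section \<open>Inner products and orthogonal series in L^2\<close>

lemma integral_cmod_squared:
  "(\<integral>x. f x * cnj (f x) \<partial>N) = complex_of_real (\<integral>x. (cmod (f x))\<^sup>2 \<partial>N)"
  by (simp only: complex_norm_square[symmetric] integral_complex_of_real)

lemma cnj_integral_mult_cnj:
  "cnj (\<integral>x. f x * cnj (g x) \<partial>N) = (\<integral>x. g x * cnj (f x) \<partial>N)"
  by (simp add: mult.commute flip: Bochner_Integration.integral_cnj)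

lemma LIMSEQ_squeeze_zero:
  fixes a b :: "nat \<Rightarrow> real"
  assumes "\<And>n. 0 \<le> a n" "\<And>n. a n \<le> b n" "b \<longlonglongrightarrow> 0"
  shows "a \<longlonglongrightarrow> 0"
  using assms by (intro tendsto_sandwich[OF _ _ tendsto_const, of 0 a _ b]) simp_all

text \<open>Integration against \<open>g\<close> is continuous on L^2: by Cauchy-Schwarz the squared
  error of the partial sums is at most \<open>A n * G\<close>.\<close>

lemma L2_sums_imp_sums_integral_mult:
  assumes "L2_sums N f s" "square_integrable N g"
  shows "(\<lambda>l. \<integral>x. f l x * g x \<partial>N) sums (\<integral>x. s x * g x \<partial>N)"
proof -
  have f: "square_integrable N (f l)" for l using assms by (simp add: L2_sums_def)
  have s: "square_integrable N s" using assms by (simp add: L2_sums_def)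
  define A where "A n = (\<integral>x. (cmod ((\<Sum>l<n. f l x) - s x))\<^sup>2 \<partial>N)" for n
  define G where "G = (\<integral>x. (cmod (g x))\<^sup>2 \<partial>N)"
  have bound: "(cmod ((\<Sum>l<n. \<integral>x. f l x * g x \<partial>N) - (\<integral>x. s x * g x \<partial>N)))\<^sup>2 \<le> A n * G" for n
  proof -
    have "(\<Sum>l<n. \<integral>x. f l x * g x \<partial>N) - (\<integral>x. s x * g x \<partial>N) = (\<integral>x. ((\<Sum>l<n. f l x) - s x) * g x \<partial>N)"
      using f s assms(2)
      by (simp add: left_diff_distrib sum_distrib_right integrable_mult_square_integrable)
    then show ?thesis
      unfolding A_def G_def using f s assms(2)
      by (simp add: Cauchy_Schwarz_square_integrable square_integrable_diff square_integrable_sum)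
  qed
  have "(\<lambda>n. A n * G) \<longlonglongrightarrow> 0"
    using assms by (intro tendsto_mult_left_zero) (simp add: A_def L2_sums_def)
  then have "(\<lambda>n. (cmod ((\<Sum>l<n. \<integral>x. f l x * g x \<partial>N) - (\<integral>x. s x * g x \<partial>N)))\<^sup>2) \<longlonglongrightarrow> 0"
    by (rule LIMSEQ_squeeze_zero[OF _ bound, rotated]) simp_all
  then have "(\<lambda>n. (\<Sum>l<n. \<integral>x. f l x * g x \<partial>N) - (\<integral>x. s x * g x \<partial>N)) \<longlonglongrightarrow> 0"
    by (simp add: tendsto_norm_zero_iff)
  then show ?thesis
    unfolding sums_def by (rule LIM_zero_cancel)
qed

text \<open>Two expansions in turn: expanding \<open>t\<close> shows that \<open>f l\<close> pairs
  only with \<open>g l\<close>, and expanding \<open>s\<close> sums these diagonal terms, as in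
  Parseval's identity.\<close>

lemma L2_sums_imp_sums_integral_mult_cnj:
  assumes "L2_sums N f s" "L2_sums N g t"
    and "\<And>k l. k \<noteq> l \<Longrightarrow> (\<integral>x. f k x * cnj (g l x) \<partial>N) = 0"
  shows "(\<lambda>l. \<integral>x. f l x * cnj (g l x) \<partial>N) sums (\<integral>x. s x * cnj (t x) \<partial>N)"
proof -
  have fl: "square_integrable N (f l)" for l using assms by (simp add: L2_sums_def)
  have t: "square_integrable N t" using assms by (simp add: L2_sums_def)
  have "(\<integral>x. f l x * cnj (t x) \<partial>N) = (\<integral>x. f l x * cnj (g l x) \<partial>N)" for l
  proof -
    have "(\<lambda>k. \<integral>x. g k x * cnj (f l x) \<partial>N) sums (\<integral>x. t x * cnj (f l x) \<partial>N)"
      by (rule L2_sums_imp_sums_integral_mult[OF assms(2) square_integrable_cnj[OF fl]])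
    moreover have "(\<lambda>k. \<integral>x. g k x * cnj (f l x) \<partial>N) sums (\<integral>x. g l x * cnj (f l x) \<partial>N)"
    proof -
      have "(\<integral>x. g k x * cnj (f l x) \<partial>N) = (if k = l then \<integral>x. g k x * cnj (f l x) \<partial>N else 0)" for k
        using arg_cong[OF assms(3)[of l k], of cnj] by (auto simp: cnj_integral_mult_cnj)
      then show ?thesis using sums_single[of l "\<lambda>k. \<integral>x. g k x * cnj (f l x) \<partial>N"] by simp
    qed
    ultimately have "(\<integral>x. t x * cnj (f l x) \<partial>N) = (\<integral>x. g l x * cnj (f l x) \<partial>N)"
      by (rule sums_unique2)
    from arg_cong[OF this, of cnj] show ?thesis by (simp add: cnj_integral_mult_cnj)
  qed
  then show ?thesis
    using L2_sums_imp_sums_integral_mult[OF assms(1) square_integrable_cnj[OF t]] by simp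
qed

lemma integral_mult_cnj_sum:
  assumes "finite A" "finite B"
    and "\<And>i. i \<in> A \<Longrightarrow> square_integrable N (f i)"
    and "\<And>j. j \<in> B \<Longrightarrow> square_integrable N (g j)"
  shows "(\<integral>x. (\<Sum>i\<in>A. f i x) * cnj (\<Sum>j\<in>B. g j x) \<partial>N)
       = (\<Sum>i\<in>A. \<Sum>j\<in>B. \<integral>x. f i x * cnj (g j x) \<partial>N)"
proof -
  have "integrable N (\<lambda>x. f i x * cnj (g j x))" if "i \<in> A" "j \<in> B" for i j
    using assms that by (intro integrable_mult_square_integrable square_integrable_cnj)
  then show ?thesis by (simp add: sum_product)
qed

lemma pythagoras_square_integrable:
  assumes "finite A" "\<And>l. square_integrable N (f l)"
    and "\<And>k l. k \<noteq> l \<Longrightarrow> (\<integral>x. f k x * cnj (f l x) \<partial>N) = 0"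
  shows "(\<integral>x. (cmod (\<Sum>l\<in>A. f l x))\<^sup>2 \<partial>N) = (\<Sum>l\<in>A. \<integral>x. (cmod (f l x))\<^sup>2 \<partial>N)"
proof -
  have "(\<integral>x. (\<Sum>l\<in>A. f l x) * cnj (\<Sum>l\<in>A. f l x) \<partial>N) = (\<Sum>k\<in>A. \<Sum>l\<in>A. \<integral>x. f k x * cnj (f l x) \<partial>N)"
    using assms by (intro integral_mult_cnj_sum) auto
  also have "\<dots> = (\<Sum>k\<in>A. \<Sum>l\<in>A. if l = k then \<integral>x. f k x * cnj (f k x) \<partial>N else 0)"
    using assms(3) by (intro sum.cong refl) auto
  also have "\<dots> = (\<Sum>k\<in>A. \<integral>x. f k x * cnj (f k x) \<partial>N)"
    using assms(1) by simp
  finally show ?thesis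
    unfolding integral_cmod_squared by (simp flip: of_real_sum)
qed

text \<open>The last hypothesis makes \<open>f l\<close> the orthogonal projection of
  \<open>g\<close> onto its own span. Hence both cross terms in the squared norm of
  \<open>g - S\<close> equal \<open>c\<close>, and this nonnegative number is the squared norm of
  \<open>g\<close> minus \<open>c\<close>.\<close>

lemma bessel_square_integrable:
  fixes f :: "nat \<Rightarrow> 'a \<Rightarrow> complex"
  assumes "square_integrable N g" "\<And>l. square_integrable N (f l)"
    and "\<And>k l. k \<noteq> l \<Longrightarrow> (\<integral>x. f k x * cnj (f l x) \<partial>N) = 0"
    and "\<And>l. (\<integral>x. g x * cnj (f l x) \<partial>N) = (\<integral>x. f l x * cnj (f l x) \<partial>N)"
  shows "(\<Sum>l<n. \<integral>x. (cmod (f l x))\<^sup>2 \<partial>N) \<le> (\<integral>x. (cmod (g x))\<^sup>2 \<partial>N)"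
proof -
  define S where "S x = (\<Sum>l<n. f l x)" for x
  define c where "c = (\<Sum>l<n. \<integral>x. (cmod (f l x))\<^sup>2 \<partial>N)"
  have S: "square_integrable N S" unfolding S_def using assms(2) by (intro square_integrable_sum) auto
  have SS: "(\<integral>x. S x * cnj (S x) \<partial>N) = complex_of_real c"
    unfolding S_def c_def integral_cmod_squared
    using pythagoras_square_integrable[OF finite_lessThan[of n], of N f] assms(2,3) by simp
  \<comment> \<open>A one-element index set presents \<open>g\<close> as a sum.\<close>
  have "(\<integral>x. g x * cnj (S x) \<partial>N) = (\<Sum>l<n. \<integral>x. g x * cnj (f l x) \<partial>N)"
    using integral_mult_cnj_sum[of "{()}" "{..<n}" N "\<lambda>_. g" f] assms by (simp add: S_def)
  also have "\<dots> = complex_of_real c"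
    unfolding assms(4) integral_cmod_squared c_def by simp
  finally have gS: "(\<integral>x. g x * cnj (S x) \<partial>N) = complex_of_real c" .
  have Sg: "(\<integral>x. S x * cnj (g x) \<partial>N) = complex_of_real c"
    using arg_cong[OF gS, of cnj] by (simp add: cnj_integral_mult_cnj)
  have int: "integrable N (\<lambda>x. u x * cnj (v x))" if "square_integrable N u" "square_integrable N v" for u v
    using that by (intro integrable_mult_square_integrable square_integrable_cnj)
  have "complex_of_real (\<integral>x. (cmod (g x - S x))\<^sup>2 \<partial>N)
      = (\<integral>x. g x * cnj (g x) - g x * cnj (S x) - S x * cnj (g x) + S x * cnj (S x) \<partial>N)"
    unfolding integral_cmod_squared[symmetric] by (intro Bochner_Integration.integral_cong) (simp_all add: algebra_simps)
  also have "\<dots> = complex_of_real (\<integral>x. (cmod (g x))\<^sup>2 \<partial>N) - complex_of_real c"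
    using int assms(1) S by (simp add: gS Sg) (simp add: SS flip: integral_cmod_squared)
  finally have "(\<integral>x. (cmod (g x - S x))\<^sup>2 \<partial>N) = (\<integral>x. (cmod (g x))\<^sup>2 \<partial>N) - c"
    unfolding of_real_diff[symmetric] of_real_eq_iff .
  moreover have "0 \<le> (\<integral>x. (cmod (g x - S x))\<^sup>2 \<partial>N)" by simp
  ultimately show ?thesis by (simp add: c_def)
qed

text \<open>Riesz-Fischer for orthogonal series: by Pythagoras the partial sums are Cauchy in L^2,
  hence in L^1 because the measure is finite, so a subsequence converges almost everywhere. Fatou's
  lemma turns the pointwise limit into a limit in L^2.\<close>

lemma (in finite_measure) L2_sums_exists:
  assumes sqi: "\<And>l. square_integrable M (f l)"
    and orth: "\<And>k l. k \<noteq> l \<Longrightarrow> (\<integral>x. f k x * cnj (f l x) \<partial>M) = 0"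
    and summable: "summable (\<lambda>l. \<integral>x. (cmod (f l x))\<^sup>2 \<partial>M)"
  shows "\<exists>s. L2_sums M f s"
proof -
  define S where "S n x = (\<Sum>l<n. f l x)" for n x
  have S: "square_integrable M (S n)" for n
    unfolding S_def using sqi by (intro square_integrable_sum) auto
  then have [measurable]: "S n \<in> borel_measurable M" for n by (simp add: square_integrable_def)
  have one: "square_integrable M (\<lambda>x. 1)" by (simp add: square_integrable_def)
  have cauchy: "\<exists>n0. \<forall>i\<ge>n0. \<forall>j\<ge>n0. (\<integral>x. (cmod (S i x - S j x))\<^sup>2 \<partial>M) < e" if e: "e > 0" for e
  proof -
    obtain n0 where n0: "\<forall>m\<ge>n0. \<forall>n. norm (\<Sum>l=m..<n. \<integral>x. (cmod (f l x))\<^sup>2 \<partial>M) < e"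
      using summable e unfolding summable_Cauchy by blast
    have le: "(\<integral>x. (cmod (S i x - S j x))\<^sup>2 \<partial>M) < e" if "j \<le> i" "j \<ge> n0" for i j
    proof -
      have "S i x - S j x = (\<Sum>l=j..<i. f l x)" for x
        unfolding S_def lessThan_atLeast0 using that by (simp add: sum_diff_nat_ivl)
      then have "(\<integral>x. (cmod (S i x - S j x))\<^sup>2 \<partial>M) = (\<Sum>l=j..<i. \<integral>x. (cmod (f l x))\<^sup>2 \<partial>M)"
        using pythagoras_square_integrable[of "{j..<i}" M f] sqi orth by simp
      then show ?thesis using n0[rule_format, OF \<open>j \<ge> n0\<close>, of i] by simp
    qed
    have "(\<integral>x. (cmod (S i x - S j x))\<^sup>2 \<partial>M) < e" if "i \<ge> n0" "j \<ge> n0" for i j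
      using le[of i j] le[of j i] that by (cases "i \<le> j") (auto simp: norm_minus_commute)
    then show ?thesis by (intro exI[of _ n0]) simp
  qed
  have cauchy1: "\<exists>n0. \<forall>i\<ge>n0. \<forall>j\<ge>n0. (\<integral>x. norm (S i x - S j x) \<partial>M) < e" if "e > 0" for e
  proof -
    \<comment> \<open>The added 1 keeps the divisor positive even for the zero measure.\<close>
    define \<mu> where "\<mu> = measure M (space M) + 1"
    have \<mu>: "\<mu> > 0" by (simp add: \<mu>_def add_nonneg_pos)
    then obtain n0 where n0: "\<And>i j. i \<ge> n0 \<Longrightarrow> j \<ge> n0 \<Longrightarrow> (\<integral>x. (cmod (S i x - S j x))\<^sup>2 \<partial>M) < e\<^sup>2 / \<mu>"
      using cauchy[of "e\<^sup>2 / \<mu>"] \<open>e > 0\<close> by auto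
    have "(\<integral>x. norm (S i x - S j x) \<partial>M) < e" if "i \<ge> n0" "j \<ge> n0" for i j
    proof -
      \<comment> \<open>Taking the modulus before applying Cauchy-Schwarz against 1 bounds the
        integral of the modulus, not merely the modulus of the integral.\<close>
      have "square_integrable M (\<lambda>x. complex_of_real (cmod (S i x - S j x)))"
        using square_integrable_diff[OF S S, of i j] by (simp add: square_integrable_def)
      from Cauchy_Schwarz_square_integrable[OF this one]
      have "(\<integral>x. norm (S i x - S j x) \<partial>M)\<^sup>2 \<le> (\<integral>x. (cmod (S i x - S j x))\<^sup>2 \<partial>M) * measure M (space M)"
        by simp
      also have "\<dots> \<le> (\<integral>x. (cmod (S i x - S j x))\<^sup>2 \<partial>M) * \<mu>"
        by (intro mult_left_mono) (auto simp: \<mu>_def)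
      also have "\<dots> < e\<^sup>2 / \<mu> * \<mu>"
        using n0[OF that] \<mu> by (intro mult_strict_right_mono)
      finally have "(\<integral>x. norm (S i x - S j x) \<partial>M)\<^sup>2 < e\<^sup>2" using \<mu> by simp
      then show ?thesis by (rule power2_less_imp_less) (use \<open>e > 0\<close> in simp)
    qed
    then show ?thesis by (intro exI[of _ n0]) simp
  qed
  have intS: "integrable M (S n)" for n
    using integrable_mult_square_integrable[OF S one] by simp
  obtain r where r: "strict_mono r" "AE x in M. Cauchy (\<lambda>i. S (r i) x)"
    using cauchy_L1_AE_cauchy_subseq[OF intS cauchy1] by metis
  \<comment> \<open>Defining \<open>s\<close> by \<open>lim\<close> everywhere keeps it measurable;
    its values matter only where the subsequence is Cauchy.\<close>
  define s where "s x = lim (\<lambda>i. S (r i) x)" for x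
  have [measurable]: "s \<in> borel_measurable M" unfolding s_def by measurable
  have lim_s: "AE x in M. (\<lambda>i. S (r i) x) \<longlonglongrightarrow> s x"
    using r(2) unfolding s_def by (auto simp: convergent_LIMSEQ_iff Cauchy_convergent_iff)
  have tail: "\<exists>n0. \<forall>n\<ge>n0. (\<integral>\<^sup>+x. ennreal ((cmod (S n x - s x))\<^sup>2) \<partial>M) \<le> ennreal e" if e: "e > 0" for e
  proof -
    obtain n0 where n0: "\<And>i j. i \<ge> n0 \<Longrightarrow> j \<ge> n0 \<Longrightarrow> (\<integral>x. (cmod (S i x - S j x))\<^sup>2 \<partial>M) < e"
      using cauchy[OF e] by metis
    have "(\<integral>\<^sup>+x. ennreal ((cmod (S n x - s x))\<^sup>2) \<partial>M) \<le> ennreal e" if "n \<ge> n0" for n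
    proof -
      \<comment> \<open>Fatou's lemma along the subsequence: \<open>n\<close> stays fixed while the
        second index of the Cauchy bound tends to infinity.\<close>
      have "AE x in M. ennreal ((cmod (S n x - s x))\<^sup>2)
          = liminf (\<lambda>i. ennreal ((cmod (S n x - S (r i) x))\<^sup>2))"
        using lim_s
      proof eventually_elim
        case (elim x)
        have "(\<lambda>i. ennreal ((cmod (S n x - S (r i) x))\<^sup>2)) \<longlonglongrightarrow> ennreal ((cmod (S n x - s x))\<^sup>2)"
          by (intro tendsto_ennrealI tendsto_intros elim)
        then show ?case by (intro lim_imp_Liminf[symmetric]) simp
      qed
      then have "(\<integral>\<^sup>+x. ennreal ((cmod (S n x - s x))\<^sup>2) \<partial>M)
          = (\<integral>\<^sup>+x. liminf (\<lambda>i. ennreal ((cmod (S n x - S (r i) x))\<^sup>2)) \<partial>M)"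
        by (rule nn_integral_cong_AE)
      also have "\<dots> \<le> liminf (\<lambda>i. \<integral>\<^sup>+x. ennreal ((cmod (S n x - S (r i) x))\<^sup>2) \<partial>M)"
        by (rule nn_integral_liminf) simp
      also have "\<dots> \<le> liminf (\<lambda>i. ennreal e)"
      proof (intro Liminf_mono eventually_sequentiallyI[of n0])
        fix i assume "i \<ge> n0"
        then have "r i \<ge> n0" using seq_suble[OF r(1), of i] by simp
        then show "(\<integral>\<^sup>+x. ennreal ((cmod (S n x - S (r i) x))\<^sup>2) \<partial>M) \<le> ennreal e"
          using n0[OF \<open>n \<ge> n0\<close>, of "r i"] square_integrable_diff[OF S S, of n "r i"]
          by (subst nn_integral_eq_integral) (auto simp: square_integrable_def intro: ennreal_leI)
      qed
      finally show ?thesis by (simp add: Liminf_const)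
    qed
    then show ?thesis by (intro exI[of _ n0]) simp
  qed
  \<comment> \<open>One finite error puts \<open>s\<close> in L^2, since
    \<open>s = S n1 - (S n1 - s)\<close>.\<close>
  obtain n1 where n1: "(\<integral>\<^sup>+x. ennreal ((cmod (S n1 x - s x))\<^sup>2) \<partial>M) \<le> ennreal 1"
    using tail[of 1] by auto
  have "square_integrable M (\<lambda>x. S n1 x - s x)"
    unfolding square_integrable_def integrable_iff_bounded using n1 by (auto intro: le_less_trans)
  from square_integrable_diff[OF S[of n1] this] have s: "square_integrable M s" by simp
  have "(\<lambda>n. \<integral>x. (cmod (S n x - s x))\<^sup>2 \<partial>M) \<longlonglongrightarrow> 0"
  proof (rule LIMSEQ_I)
    fix e :: real assume "e > 0"
    then obtain n0 where n0: "\<And>n. n \<ge> n0 \<Longrightarrow> (\<integral>\<^sup>+x. ennreal ((cmod (S n x - s x))\<^sup>2) \<partial>M) \<le> ennreal (e / 2)"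
      using tail[of "e / 2"] by auto
    have "norm ((\<integral>x. (cmod (S n x - s x))\<^sup>2 \<partial>M) - 0) < e" if "n \<ge> n0" for n
      using n0[OF that] square_integrable_diff[OF S s, of n] \<open>e > 0\<close>
      by (subst (asm) nn_integral_eq_integral) (auto simp: square_integrable_def ennreal_le_iff)
    then show "\<exists>n0. \<forall>n\<ge>n0. norm ((\<integral>x. (cmod (S n x - s x))\<^sup>2 \<partial>M) - 0) < e" by blast
  qed
  then show ?thesis
    unfolding L2_sums_def using sqi s by (auto simp: S_def)
qed

section \<open>Integration over one factor of a product space\<close>

text \<open>Fubini for the squared modulus makes almost every section square integrable;
  Cauchy-Schwarz on these sections, integrated over \<open>M1\<close>, yields the bound. So pairing
  with \<open>k\<close> maps L^2 of the product boundedly to L^2 of the first factor.\<close>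

lemma (in pair_sigma_finite)
  assumes F: "square_integrable (M1 \<Otimes>\<^sub>M M2) F"
  shows AE_square_integrable_section: "AE \<omega> in M1. square_integrable M2 (\<lambda>x. F (\<omega>, x))"
    and square_integrable_integral_section:
      "square_integrable M2 k \<Longrightarrow> square_integrable M1 (\<lambda>\<omega>. \<integral>x. F (\<omega>, x) * k x \<partial>M2)" (is "_ \<Longrightarrow> ?sq")
    and integral_section_bound:
      "square_integrable M2 k \<Longrightarrow> (\<integral>\<omega>. (cmod (\<integral>x. F (\<omega>, x) * k x \<partial>M2))\<^sup>2 \<partial>M1)
         \<le> (\<integral>z. (cmod (F z))\<^sup>2 \<partial>(M1 \<Otimes>\<^sub>M M2)) * (\<integral>x. (cmod (k x))\<^sup>2 \<partial>M2)" (is "_ \<Longrightarrow> ?le")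
proof -
  have F_meas[measurable]: "F \<in> borel_measurable (M1 \<Otimes>\<^sub>M M2)"
    and F_int: "integrable (M1 \<Otimes>\<^sub>M M2) (\<lambda>z. (cmod (F z))\<^sup>2)"
    using F by (auto simp: square_integrable_def)
  show AE: "AE \<omega> in M1. square_integrable M2 (\<lambda>x. F (\<omega>, x))"
    using AE_integrable_fst'[OF F_int] AE_space
  proof eventually_elim
    case (elim \<omega>)
    then show ?case using F_meas by (auto simp: square_integrable_def)
  qed
  assume k: "square_integrable M2 k"
  then have [measurable]: "k \<in> borel_measurable M2" by (simp add: square_integrable_def)
  define K where "K = (\<integral>x. (cmod (k x))\<^sup>2 \<partial>M2)"
  have bound: "AE \<omega> in M1. (cmod (\<integral>x. F (\<omega>, x) * k x \<partial>M2))\<^sup>2 \<le> (\<integral>x. (cmod (F (\<omega>, x)))\<^sup>2 \<partial>M2) * K"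
    using AE by eventually_elim (auto simp: K_def intro: Cauchy_Schwarz_square_integrable k)
  have int: "integrable M1 (\<lambda>\<omega>. (\<integral>x. (cmod (F (\<omega>, x)))\<^sup>2 \<partial>M2) * K)"
    using integrable_fst'[OF F_int] by simp
  show sq: ?sq
    by (rule square_integrable_bound[OF int _ bound]) measurable
  have "(\<integral>\<omega>. (cmod (\<integral>x. F (\<omega>, x) * k x \<partial>M2))\<^sup>2 \<partial>M1) \<le> (\<integral>\<omega>. (\<integral>x. (cmod (F (\<omega>, x)))\<^sup>2 \<partial>M2) * K \<partial>M1)"
    using sq int bound by (intro integral_mono_AE) (auto simp: square_integrable_def)
  also have "\<dots> = (\<integral>z. (cmod (F z))\<^sup>2 \<partial>(M1 \<Otimes>\<^sub>M M2)) * K"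
    using integral_fst'[OF F_int] by simp
  finally show ?le by (simp add: K_def)
qed

text \<open>Pairing sections with \<open>k\<close> is linear and bounded, so it carries the L^2
  limit along.\<close>

lemma (in pair_sigma_finite) L2_sums_integral_section:
  assumes "L2_sums (M1 \<Otimes>\<^sub>M M2) f s" "square_integrable M2 k"
  shows "L2_sums M1 (\<lambda>l \<omega>. \<integral>x. f l (\<omega>, x) * k x \<partial>M2) (\<lambda>\<omega>. \<integral>x. s (\<omega>, x) * k x \<partial>M2)"
proof -
  have f: "square_integrable (M1 \<Otimes>\<^sub>M M2) (f l)" for l using assms by (simp add: L2_sums_def)
  have s: "square_integrable (M1 \<Otimes>\<^sub>M M2) s" using assms by (simp add: L2_sums_def)
  have f1: "square_integrable M1 (\<lambda>\<omega>. \<integral>x. f l (\<omega>, x) * k x \<partial>M2)" for l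
    by (rule square_integrable_integral_section[OF f assms(2)])
  have s1: "square_integrable M1 (\<lambda>\<omega>. \<integral>x. s (\<omega>, x) * k x \<partial>M2)"
    by (rule square_integrable_integral_section[OF s assms(2)])
  define A where "A n = (\<integral>z. (cmod ((\<Sum>l<n. f l z) - s z))\<^sup>2 \<partial>(M1 \<Otimes>\<^sub>M M2))" for n
  define K where "K = (\<integral>x. (cmod (k x))\<^sup>2 \<partial>M2)"
  have bound: "(\<integral>\<omega>. (cmod ((\<Sum>l<n. \<integral>x. f l (\<omega>, x) * k x \<partial>M2) - (\<integral>x. s (\<omega>, x) * k x \<partial>M2)))\<^sup>2 \<partial>M1) \<le> A n * K"
    (is "?L \<le> _") for n
  proof -
    let ?F = "\<lambda>z. (\<Sum>l<n. f l z) - s z"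
    have F: "square_integrable (M1 \<Otimes>\<^sub>M M2) ?F"
      using f s by (intro square_integrable_diff square_integrable_sum)
    \<comment> \<open>The section integral is shown to be additive for almost every
      \<open>\<omega>\<close>; exchanging integrands almost everywhere requires these measurability
      facts.\<close>
    have meas: "(\<lambda>\<omega>. \<Sum>l<n. \<integral>x. f l (\<omega>, x) * k x \<partial>M2) \<in> borel_measurable M1"
      "(\<lambda>\<omega>. \<integral>x. s (\<omega>, x) * k x \<partial>M2) \<in> borel_measurable M1"
      "(\<lambda>\<omega>. \<integral>x. ?F (\<omega>, x) * k x \<partial>M2) \<in> borel_measurable M1"
      using square_integrable_sum[of "{..<n}", OF f1] s1 square_integrable_integral_section[OF F assms(2)]
      by (auto simp: square_integrable_def)
    have "AE \<omega> in M1. \<forall>l. square_integrable M2 (\<lambda>x. f l (\<omega>, x))"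
      unfolding AE_all_countable using AE_square_integrable_section[OF f] by simp
    then have "AE \<omega> in M1. (\<Sum>l<n. \<integral>x. f l (\<omega>, x) * k x \<partial>M2) - (\<integral>x. s (\<omega>, x) * k x \<partial>M2)
        = (\<integral>x. ?F (\<omega>, x) * k x \<partial>M2)"
      using AE_square_integrable_section[OF s]
      by eventually_elim
         (simp add: left_diff_distrib sum_distrib_right integrable_mult_square_integrable[OF _ assms(2)])
    then have "?L = (\<integral>\<omega>. (cmod (\<integral>x. ?F (\<omega>, x) * k x \<partial>M2))\<^sup>2 \<partial>M1)"
      using meas by (intro integral_cong_AE) auto
    also have "\<dots> \<le> A n * K"
      unfolding A_def K_def by (rule integral_section_bound[OF F assms(2)])
    finally show ?thesis .
  qed
  have "(\<lambda>n. A n * K) \<longlonglongrightarrow> 0"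
    using assms by (intro tendsto_mult_left_zero) (simp add: A_def L2_sums_def)
  then have "(\<lambda>n. \<integral>\<omega>. (cmod ((\<Sum>l<n. \<integral>x. f l (\<omega>, x) * k x \<partial>M2) - (\<integral>x. s (\<omega>, x) * k x \<partial>M2)))\<^sup>2 \<partial>M1) \<longlonglongrightarrow> 0"
    by (rule LIMSEQ_squeeze_zero[OF _ bound, rotated]) simp_all
  then show ?thesis unfolding L2_sums_def using f1 s1 by auto
qed

lemma (in pair_sigma_finite)
  fixes a b :: "_ \<Rightarrow> complex"
  assumes a: "integrable M1 a" and b: "integrable M2 b"
  shows integrable_mult_pair: "integrable (M1 \<Otimes>\<^sub>M M2) (\<lambda>z. a (fst z) * b (snd z))"
    and integral_mult_pair:
      "(\<integral>z. a (fst z) * b (snd z) \<partial>(M1 \<Otimes>\<^sub>M M2)) = (\<integral>\<omega>. a \<omega> \<partial>M1) * (\<integral>x. b x \<partial>M2)"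
proof -
  have [measurable]: "a \<in> borel_measurable M1" "b \<in> borel_measurable M2" using a b by auto
  show int: "integrable (M1 \<Otimes>\<^sub>M M2) (\<lambda>z. a (fst z) * b (snd z))"
    using a b by (intro Fubini_integrable) (auto simp: norm_mult)
  show "(\<integral>z. a (fst z) * b (snd z) \<partial>(M1 \<Otimes>\<^sub>M M2)) = (\<integral>\<omega>. a \<omega> \<partial>M1) * (\<integral>x. b x \<partial>M2)"
    using integral_fst'[OF int] by simp
qed

lemma (in pair_sigma_finite) square_integrable_mult_pair:
  assumes "square_integrable M1 a" "square_integrable M2 b"
  shows "square_integrable (M1 \<Otimes>\<^sub>M M2) (\<lambda>z. a (fst z) * b (snd z))"
proof -
  have [measurable]: "a \<in> borel_measurable M1" "b \<in> borel_measurable M2"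
    using assms by (auto simp: square_integrable_def)
  have "integrable (M1 \<Otimes>\<^sub>M M2) (\<lambda>z. complex_of_real ((cmod (a (fst z)))\<^sup>2) * complex_of_real ((cmod (b (snd z)))\<^sup>2))"
    using assms by (intro integrable_mult_pair integrable_of_real) (simp_all add: square_integrable_def)
  then have "integrable (M1 \<Otimes>\<^sub>M M2) (\<lambda>z. complex_of_real ((cmod (a (fst z) * b (snd z)))\<^sup>2))"
    by (simp add: norm_mult power_mult_distrib)
  then show ?thesis unfolding square_integrable_def complex_of_real_integrable_eq by auto
qed

section \<open>Legendre polynomials\<close>

lemma pderiv_funpow_smult: "(pderiv ^^ n) (smult c p) = smult c ((pderiv ^^ n) p)"
  by (induction n) (simp_all add: pderiv_smult)

text \<open>The power \<open>u = (x^2 - 1)^l\<close> satisfies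
  \<open>(x^2 - 1) u' = 2 l x u\<close>. Differentiating this \<open>n + 1\<close> times gives the
  equation, one differentiation per induction step.\<close>

lemma rodrigues_power_ode:
  fixes t :: real
  defines "u l \<equiv> ([:-1, 0, 1:] :: real poly) ^ l"
  shows "(t\<^sup>2 - 1) * poly ((pderiv ^^ (n + 2)) (u l)) t
      + 2 * (real n + 1 - real l) * t * poly ((pderiv ^^ (n + 1)) (u l)) t
      + (real n + 1) * (real n - 2 * real l) * poly ((pderiv ^^ n) (u l)) t = 0"
proof -
  have first: "[:-1, 0, 1:] * pderiv (u l) = smult (2 * real l) ([:0, 1:] * u l)"
  proof (cases l)
    case (Suc n)
    have "pderiv [:-1, 0, 1::real:] = smult 2 [:0, 1:]" by (simp add: pderiv_pCons)
    moreover have "p * (smult (real (Suc n)) (p ^ n) * smult 2 q) = smult (2 * real (Suc n)) (q * p ^ Suc n)"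
      for p q :: "real poly" by (simp add: mult_ac)
    ultimately show ?thesis
      unfolding u_def Suc pderiv_power_Suc by (simp only:)
  qed (simp add: u_def)
  have "[:-1, 0, 1:] * (pderiv ^^ (n + 2)) (u l)
      + smult (2 * (real n + 1 - real l)) ([:0, 1:] * (pderiv ^^ (n + 1)) (u l))
      + smult ((real n + 1) * (real n - 2 * real l)) ((pderiv ^^ n) (u l)) = 0"
  proof (induction n)
    case 0
    from arg_cong[OF first, of "\<lambda>p. poly (pderiv p)"]
    show ?case
      by (simp add: poly_eq_poly_eq_iff[symmetric] fun_eq_iff pderiv_mult pderiv_smult pderiv_add
          pderiv_diff pderiv_pCons algebra_simps power2_eq_square)
  next
    case (Suc n)
    from arg_cong[OF Suc, of "\<lambda>p. poly (pderiv p)"]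
    show ?case
      by (simp add: poly_eq_poly_eq_iff[symmetric] fun_eq_iff pderiv_mult pderiv_smult pderiv_add
          pderiv_diff pderiv_pCons algebra_simps power2_eq_square)
  qed
  from arg_cong[OF this, of "\<lambda>p. poly p t"] show ?thesis
    by (simp add: algebra_simps power2_eq_square)
qed

abbreviation legendre_deriv :: "nat \<Rightarrow> nat \<Rightarrow> real poly" where
  "legendre_deriv l m \<equiv> (pderiv ^^ m) (legendre_poly l)"

text \<open>As \<open>legendre_poly l\<close> is a multiple of the \<open>l\<close>-th derivative of
  \<open>(x^2 - 1)^l\<close>, this is the preceding equation at order \<open>l + m\<close>. For
  \<open>m = 0\<close> it is Legendre's differential equation.\<close>

lemma legendre_deriv_ode:
  "(1 - t\<^sup>2) * poly (legendre_deriv l (m + 2)) t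
     - 2 * (real m + 1) * t * poly (legendre_deriv l (m + 1)) t
     + (real l - real m) * (real l + real m + 1) * poly (legendre_deriv l m) t = 0"
proof -
  have *: "legendre_deriv l k = smult (1 / (2 ^ l * fact l)) ((pderiv ^^ (l + k)) ([:-1, 0, 1:] ^ l))" for k
    unfolding legendre_poly_def pderiv_funpow_smult
    by (simp add: add.commute[of l] funpow_add)
  have "(1 / (2 ^ l * fact l)) * ((t\<^sup>2 - 1) * poly ((pderiv ^^ (l + m + 2)) ([:-1, 0, 1:] ^ l)) t
      + 2 * (real (l + m) + 1 - real l) * t * poly ((pderiv ^^ (l + m + 1)) ([:-1, 0, 1:] ^ l)) t
      + (real (l + m) + 1) * (real (l + m) - 2 * real l) * poly ((pderiv ^^ (l + m)) ([:-1, 0, 1:] ^ l)) t) = 0"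
    by (subst rodrigues_power_ode) simp
  then have "(t\<^sup>2 - 1) * poly (legendre_deriv l (m + 2)) t
      + 2 * (real (l + m) + 1 - real l) * t * poly (legendre_deriv l (m + 1)) t
      + (real (l + m) + 1) * (real (l + m) - 2 * real l) * poly (legendre_deriv l m) t = 0"
    unfolding * poly_smult by (simp only: distrib_left mult_ac add_ac)
  then show ?thesis by (simp add: algebra_simps)
qed

lemma legendre_deriv_eq_0: "legendre_deriv l (Suc l) = 0"
proof -
  have deg: "degree ((pderiv ^^ k) p) = degree p - k" for k and p :: "real poly"
    by (induction k) (simp_all add: degree_pderiv)
  have "degree (legendre_deriv l l) = 0"
    unfolding deg legendre_poly_def by (simp add: deg degree_power_eq)
  then obtain a where "legendre_deriv l l = [:a:]" by (rule degree_eq_zeroE)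
  then show ?thesis by (simp add: pderiv_pCons)
qed

text \<open>By Leibniz' rule only the term with all derivatives on the power survives at
  \<open>a\<close>. In the induction, one differentiation replaces \<open>q\<close> by
  \<open>(1 + k) q + (x - a) q'\<close>, whose value at \<open>a\<close> is
  \<open>(1 + k) q(a)\<close>.\<close>

lemma pderiv_funpow_mult_linear_power:
  fixes a :: real
  shows "poly ((pderiv ^^ k) ([:-a, 1:] ^ k * q)) a = fact k * poly q a"
proof (induction k arbitrary: q)
  case (Suc k)
  have "pderiv ([:-a, 1:] ^ Suc k * q)
      = [:-a, 1:] ^ k * (smult (1 + real k) q + [:-a, 1:] * pderiv q)"
    by (simp only: pderiv_mult pderiv_power_Suc) (simp add: pderiv_pCons algebra_simps)
  then show ?case
    unfolding funpow_Suc_right comp_def by (simp only: Suc) (simp add: algebra_simps)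
qed simp

text \<open>Splitting off \<open>(x - 1)^l\<close> leaves the cofactor \<open>(x + 1)^l\<close>,
  which is \<open>2^l\<close> at 1; the normalisation in Rodrigues' formula cancels it together with
  \<open>fact l\<close>.\<close>

lemma poly_legendre_poly_1: "poly (legendre_poly l) 1 = 1"
proof -
  have "([:-1, 0, 1:] :: real poly) ^ l = [:-1, 1:] ^ l * [:1, 1:] ^ l"
    by (simp flip: power_mult_distrib)
  then show ?thesis
    unfolding legendre_poly_def by (simp add: pderiv_funpow_mult_linear_power)
qed

text \<open>The derivative of the left-hand side telescopes: writing \<open>D m\<close> for the \<open>m\<close>-th derivative of the
  Legendre polynomial, the associated Legendre equation turns the derivative of the \<open>m\<close>-th summand
  into \<open>E m - E (m - 1)\<close> with \<open>E m = (l - m)! / (l + m)! * (1 - t\<^sup>2) ^ m * D m * D (m + 1)\<close>,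
  and \<open>E l = 0\<close>. So the sum is constant, and its value is read off at \<open>t = 1\<close>.\<close>

lemma legendre_sum_squares:
  "(poly (legendre_poly l) t)\<^sup>2
     + 2 * (\<Sum>m=1..l. fact (l - m) / fact (l + m) * (1 - t\<^sup>2) ^ m * (poly (legendre_deriv l m) t)\<^sup>2) = 1"
proof -
  define D where "D m t = poly (legendre_deriv l m) t" for m t
  define c :: "nat \<Rightarrow> real" where "c m = fact (l - m) / fact (l + m)" for m
  define E where "E t m = c m * (1 - t\<^sup>2) ^ m * D m t * D (Suc m) t" for t m
  define S where "S t = (D 0 t)\<^sup>2 + 2 * (\<Sum>m=1..l. c m * (1 - t\<^sup>2) ^ m * (D m t)\<^sup>2)" for t
  have D': "(D m has_real_derivative D (Suc m) t) (at t)" for m t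
    unfolding D_def using poly_DERIV by simp
  have ode: "2 * (real m + 1) * t * D (m + 1) t
      = (1 - t\<^sup>2) * D (m + 2) t + (real l - real m) * (real l + real m + 1) * D m t" for m t
    using legendre_deriv_ode[of t m l] by (simp add: D_def)
  have term': "((\<lambda>t. c m * (1 - t\<^sup>2) ^ m * (D m t)\<^sup>2) has_real_derivative (E t m - E t (m - 1))) (at t)"
    if "m \<in> {1..l}" for m t
  proof -
    obtain k where k: "m = Suc k" "k < l" using \<open>m \<in> {1..l}\<close> by (cases m) auto
    have "fact (l - k) = (real l - real k) * (fact (l - m) :: real)"
      using k by (simp add: fact_reduce of_nat_diff)
    moreover have "fact (l + m) = (real l + real k + 1) * (fact (l + k) :: real)"
      using k by (simp add: algebra_simps)
    moreover have "f / (b * g) * (a * b) = a * f / g" if "b \<noteq> 0" for a b f g :: real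
      using that by simp
    ultimately have cc: "c m * ((real l - real k) * (real l + real k + 1)) = c k"
      unfolding c_def by (metis of_nat_add of_nat_Suc of_nat_neq_0 add.commute plus_1_eq_Suc)
    \<comment> \<open>The last part is grouped around
      \<open>2 * (real k + 1) * t * D (k + 1) t\<close>, the expression that \<open>ode\<close>
      replaces.\<close>
    have "((\<lambda>t. c m * (1 - t\<^sup>2) ^ m * (D m t)\<^sup>2) has_real_derivative
        c m * (2 * (1 - t\<^sup>2) ^ m * D m t * D (Suc m) t
          - (1 - t\<^sup>2) ^ k * D m t * (2 * (real k + 1) * t * D (k + 1) t))) (at t)"
      unfolding k(1)
      by (rule derivative_eq_intros D' refl | simp add: algebra_simps power2_eq_square)+
    also have "c m * (2 * (1 - t\<^sup>2) ^ m * D m t * D (Suc m) t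
          - (1 - t\<^sup>2) ^ k * D m t * (2 * (real k + 1) * t * D (k + 1) t))
        = c m * (1 - t\<^sup>2) ^ m * D m t * D (Suc m) t
          - (c m * ((real l - real k) * (real l + real k + 1))) * (1 - t\<^sup>2) ^ k * D m t * D k t"
      unfolding ode using k by (simp add: algebra_simps)
    also have "\<dots> = E t m - E t (m - 1)"
      unfolding cc E_def using k by simp
    finally show ?thesis .
  qed
  have "(S has_real_derivative 0) (at t)" for t
  proof -
    have "(S has_real_derivative 2 * (D 0 t * D 1 t) + 2 * (\<Sum>m=1..l. E t m - E t (m - 1))) (at t)"
      unfolding S_def
      by (rule derivative_eq_intros D' term' refl | simp)+
    also have "(\<Sum>m=1..l. E t m - E t (m - 1)) = E t l - E t 0"
      by (induction l) auto
    also have "E t l = 0" by (simp add: E_def D_def legendre_deriv_eq_0 del: funpow.simps)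
    also have "E t 0 = D 0 t * D 1 t" by (simp add: E_def c_def)
    finally show ?thesis by simp
  qed
  then have "S t = S 1" by (intro DERIV_isconst_all) auto
  also have "S 1 = 1" by (simp add: S_def D_def poly_legendre_poly_1 zero_power)
  finally show ?thesis by (simp add: S_def D_def c_def)
qed

section \<open>Spherical harmonics\<close>

text \<open>The substitution \<open>t = cos \<theta>\<close> turns this into the integral of \<open>f\<close> over \<open>[-1, 1]\<close>.\<close>

definition polar_integral :: "(real \<Rightarrow> real) \<Rightarrow> real" where
  "polar_integral f = (\<integral>\<theta>. indicator {0..pi} \<theta> *\<^sub>R (sin \<theta> * f (cos \<theta>)) \<partial>lborel)"

lemma polar_integrable:
  assumes "continuous_on UNIV f"
  shows "integrable lborel (\<lambda>\<theta>. indicator {0..pi} \<theta> *\<^sub>R (sin \<theta> * f (cos \<theta>)) :: real)"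
proof -
  have "continuous_on {0..pi} (\<lambda>\<theta>. sin \<theta> * f (cos \<theta>))"
    by (intro continuous_intros continuous_on_compose2[OF assms]) auto
  from borel_integrable_atLeastAtMost'[OF this] show ?thesis
    by (simp add: set_integrable_def)
qed

lemma polar_integral_cmult: "polar_integral (\<lambda>t. c * f t) = c * polar_integral f"
proof -
  have "(\<lambda>\<theta>. indicator {0..pi} \<theta> *\<^sub>R (sin \<theta> * (c * f (cos \<theta>))))
      = (\<lambda>\<theta>. c * (indicator {0..pi} \<theta> *\<^sub>R (sin \<theta> * f (cos \<theta>))))"
    by (simp add: fun_eq_iff)
  then show ?thesis unfolding polar_integral_def by simp
qed

lemma polar_integral_add:
  assumes "continuous_on UNIV f" "continuous_on UNIV g"
  shows "polar_integral (\<lambda>t. f t + g t) = polar_integral f + polar_integral g"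
  unfolding polar_integral_def
  using Bochner_Integration.integral_add[OF assms[THEN polar_integrable]]
  by (simp add: algebra_simps)

lemma polar_integral_sum:
  assumes "\<And>i. continuous_on UNIV (f i)"
  shows "polar_integral (\<lambda>t. \<Sum>i\<in>I. f i t) = (\<Sum>i\<in>I. polar_integral (f i))"
  using Bochner_Integration.integral_sum[of I lborel, OF polar_integrable[OF assms]]
  by (simp add: polar_integral_def sum_distrib_left)

text \<open>The function \<open>- F (cos \<theta>)\<close> is an antiderivative of the integrand, so
  the substitution reduces to the fundamental theorem of calculus.\<close>

lemma polar_integral_FTC:
  assumes "\<And>t. (F has_real_derivative f t) (at t)" "continuous_on UNIV f"
  shows "polar_integral f = F 1 - F (-1)"
proof -
  have "polar_integral f = (- F (cos pi)) - (- F (cos 0))"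
    unfolding polar_integral_def
  proof (rule integral_FTC_Icc)
    fix \<theta> :: real
    have "((\<lambda>\<theta>. - F (cos \<theta>)) has_real_derivative sin \<theta> * f (cos \<theta>)) (at \<theta> within {0..pi})"
      by (rule derivative_eq_intros DERIV_chain2[OF assms(1)] refl | simp)+
    then show "((\<lambda>\<theta>. - F (cos \<theta>)) has_vector_derivative sin \<theta> * f (cos \<theta>)) (at \<theta> within {0..pi})"
      by (simp add: has_real_derivative_iff_has_vector_derivative)
  next
    show "continuous_on {0..pi} (\<lambda>\<theta>. sin \<theta> * f (cos \<theta>))"
      by (intro continuous_intros continuous_on_compose2[OF assms(2)]) auto
  qed simp
  then show ?thesis by simp
qed

section \<open>Orthogonality and norms of associated Legendre functions\<close>

text \<open>The weight \<open>(1 - t\<^sup>2) ^ m\<close> collects the two factors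
  \<open>sqrt (1 - t\<^sup>2) ^ m\<close>, and the phases cancel: this is the inner product on
  [-1, 1] of two associated Legendre functions of order \<open>m\<close>.\<close>

definition legendre_inner :: "nat \<Rightarrow> nat \<Rightarrow> nat \<Rightarrow> real" where
  "legendre_inner l l' m = polar_integral
     (\<lambda>t. (1 - t\<^sup>2) ^ m * poly (legendre_deriv l m) t * poly (legendre_deriv l' m) t)"

lemma legendre_inner_commute: "legendre_inner l l' m = legendre_inner l' l m"
  by (simp add: legendre_inner_def mult_ac)

text \<open>Integration by parts: the function
  \<open>(1 - t\<^sup>2) ^ Suc m * ?D l (Suc m) t * ?D l' m t\<close> vanishes at both ends, and the
  associated Legendre equation for \<open>l\<close> rewrites the second-order term of its
  derivative.\<close>

lemma legendre_inner_Suc: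
  "legendre_inner l l' (Suc m) = (real l - real m) * (real l + real m + 1) * legendre_inner l l' m"
proof -
  let ?D = "\<lambda>l m t. poly (legendre_deriv l m) t"
  let ?c = "(real l - real m) * (real l + real m + 1)"
  let ?g = "\<lambda>m t. (1 - t\<^sup>2) ^ m * ?D l m t * ?D l' m t"
  have D': "(?D l m has_real_derivative ?D l (Suc m) t) (at t)" for l m t
    using poly_DERIV by simp
  have "polar_integral (\<lambda>t. ?g (Suc m) t + (- ?c) * ?g m t)
      = (1 - 1\<^sup>2) ^ Suc m * ?D l (Suc m) 1 * ?D l' m 1
        - (1 - (-1)\<^sup>2) ^ Suc m * ?D l (Suc m) (-1) * ?D l' m (-1)"
  proof (rule polar_integral_FTC)
    fix t
    have ode: "(1 - t\<^sup>2) * ?D l (Suc (Suc m)) t = 2 * (real m + 1) * t * ?D l (Suc m) t - ?c * ?D l m t"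
      using legendre_deriv_ode[of t m l] by simp
    have "((\<lambda>t. (1 - t\<^sup>2) ^ Suc m * ?D l (Suc m) t * ?D l' m t) has_real_derivative
        ?g (Suc m) t + (1 - t\<^sup>2) ^ m * ?D l' m t *
          ((1 - t\<^sup>2) * ?D l (Suc (Suc m)) t - 2 * (real m + 1) * t * ?D l (Suc m) t)) (at t)"
      by (rule derivative_eq_intros D' refl | simp add: algebra_simps power2_eq_square del: funpow.simps)+
    then show "((\<lambda>t. (1 - t\<^sup>2) ^ Suc m * ?D l (Suc m) t * ?D l' m t) has_real_derivative
        ?g (Suc m) t + (- ?c) * ?g m t) (at t)"
      unfolding ode by (simp add: mult_ac)
  qed (intro continuous_intros)
  also have "\<dots> = 0" by simp
  finally have "polar_integral (\<lambda>t. ?g (Suc m) t + (- ?c) * ?g m t) = 0" .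
  moreover have "polar_integral (\<lambda>t. ?g (Suc m) t + (- ?c) * ?g m t)
      = polar_integral (?g (Suc m)) + (- ?c) * polar_integral (?g m)"
    unfolding polar_integral_cmult[symmetric] by (intro polar_integral_add continuous_intros)
  ultimately show ?thesis by (simp add: legendre_inner_def)
qed

text \<open>At order 0 the recurrence applies to either degree by symmetry, giving two different
  eigenvalues \<open>l * (l + 1)\<close> and \<open>l' * (l' + 1)\<close> for the same integral,
  which must vanish. The recurrence passes the zero on to every \<open>m\<close>.\<close>

lemma legendre_inner_neq:
  assumes "l \<noteq> l'"
  shows "legendre_inner l l' m = 0"
proof -
  have "legendre_inner l l' (Suc 0) = real l * (real l + 1) * legendre_inner l l' 0"
    using legendre_inner_Suc[of l l' 0] by simp
  moreover have "legendre_inner l l' (Suc 0) = real l' * (real l' + 1) * legendre_inner l l' 0"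
    using legendre_inner_Suc[of l' l 0] by (simp add: legendre_inner_commute[of l' l])
  ultimately have "(real l - real l') * (real l + real l' + 1) * legendre_inner l l' 0 = 0"
    by (simp add: algebra_simps)
  moreover have "real l + real l' + 1 \<noteq> 0" by linarith
  ultimately have "legendre_inner l l' 0 = 0" using assms by simp
  then show ?thesis by (induction m) (simp_all add: legendre_inner_Suc)
qed

text \<open>The factor in the recurrence is exactly the one by which the ratio of factorials shrinks
  from \<open>m\<close> to \<open>m + 1\<close>.\<close>

lemma legendre_inner_rescale:
  assumes "m \<le> l"
  shows "fact (l - m) / fact (l + m) * legendre_inner l l m = legendre_inner l l 0"
  using assms
proof (induction m)
  case (Suc m)
  have "fact (l - m) = (real l - real m) * (fact (l - Suc m) :: real)"
    using Suc.prems by (simp add: fact_reduce of_nat_diff)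
  moreover have "fact (l + Suc m) = (real l + real m + 1) * (fact (l + m) :: real)"
    by (simp add: algebra_simps)
  moreover have "a / (b * g) * (c * b * x) = c * a / g * x" if "b \<noteq> 0" for a b c g x :: real
    using that by simp
  ultimately have "fact (l - Suc m) / fact (l + Suc m) * legendre_inner l l (Suc m)
      = fact (l - m) / fact (l + m) * legendre_inner l l m"
    unfolding legendre_inner_Suc by (metis of_nat_add of_nat_Suc of_nat_neq_0 add.commute plus_1_eq_Suc)
  then show ?case using Suc by simp
qed simp

text \<open>After rescaling, all \<open>m\<close> contribute equally to the integral of \<open>legendre_sum_squares\<close>, which
  yields the norms without evaluating any integral of powers of \<open>1 - t\<^sup>2\<close>.\<close>

lemma legendre_inner_eq:
  assumes "m \<le> l"
  shows "(2 * real l + 1) * (fact (l - m) / fact (l + m)) * legendre_inner l l m = 2"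
proof -
  let ?g = "\<lambda>m t. fact (l - m) / fact (l + m) * ((1 - t\<^sup>2) ^ m * poly (legendre_deriv l m) t * poly (legendre_deriv l m) t)"
  have "2 = polar_integral (\<lambda>t. 1)"
    by (subst polar_integral_FTC[where F = "\<lambda>t. t"]) (auto intro!: derivative_eq_intros)
  also have "(\<lambda>t. 1) = (\<lambda>t. ?g 0 t + 2 * (\<Sum>m=1..l. ?g m t))"
  proof
    fix t show "1 = ?g 0 t + 2 * (\<Sum>m=1..l. ?g m t)"
      using legendre_sum_squares[of l t] by (simp add: power2_eq_square mult_ac)
  qed
  also have "polar_integral \<dots> = polar_integral (?g 0) + 2 * (\<Sum>m=1..l. polar_integral (?g m))"
  proof -
    have "polar_integral (\<lambda>t. ?g 0 t + 2 * (\<Sum>m=1..l. ?g m t))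
        = polar_integral (?g 0) + polar_integral (\<lambda>t. 2 * (\<Sum>m=1..l. ?g m t))"
      by (intro polar_integral_add continuous_intros)
    also have "polar_integral (\<lambda>t. 2 * (\<Sum>m=1..l. ?g m t)) = 2 * polar_integral (\<lambda>t. \<Sum>m=1..l. ?g m t)"
      by (rule polar_integral_cmult)
    also have "polar_integral (\<lambda>t. \<Sum>m=1..l. ?g m t) = (\<Sum>m=1..l. polar_integral (?g m))"
      by (intro polar_integral_sum continuous_intros)
    finally show ?thesis .
  qed
  also have "\<dots> = legendre_inner l l 0 + 2 * (\<Sum>m=1..l. legendre_inner l l 0)"
  proof -
    have g: "polar_integral (?g m) = legendre_inner l l 0" if "m \<le> l" for m
      unfolding polar_integral_cmult legendre_inner_def[symmetric] using that by (rule legendre_inner_rescale)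
    show ?thesis by (intro arg_cong2[where f = "(+)"] arg_cong2[where f = "(*)"] sum.cong refl) (rule g; simp)+
  qed
  also have "\<dots> = (2 * real l + 1) * legendre_inner l l 0" by (simp add: algebra_simps)
  finally show ?thesis unfolding mult.assoc legendre_inner_rescale[OF assms] by (rule sym)
qed

section \<open>Polar and azimuthal parts of the harmonics\<close>

lemma integral_cis_int:
  "(\<integral>\<phi>. indicator {-pi..pi} \<phi> *\<^sub>R cis (of_int k * \<phi>) \<partial>lborel) = (if k = 0 then of_real (2 * pi) else 0)"
proof (cases "k = 0")
  case True
  have "(\<integral>\<phi>. indicator {-pi..pi} \<phi> *\<^sub>R (1::complex) \<partial>lborel) = of_real pi - of_real (-pi)"
    by (rule integral_FTC_Icc) (auto intro!: derivative_eq_intros)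
  then show ?thesis using True by simp
next
  case False
  \<comment> \<open>This is \<open>exp (i k \<phi>) / (i k)\<close> in real and imaginary
    parts.\<close>
  let ?F = "\<lambda>\<phi>. Complex (sin (of_int k * \<phi>) / of_int k) (- cos (of_int k * \<phi>) / of_int k)"
  have "(\<integral>\<phi>. indicator {-pi..pi} \<phi> *\<^sub>R cis (of_int k * \<phi>) \<partial>lborel) = ?F pi - ?F (-pi)"
  proof (rule integral_FTC_Icc)
    fix \<phi> :: real
    have "((\<lambda>\<phi>. sin (of_int k * \<phi>) / of_int k) has_real_derivative cos (of_int k * \<phi>)) (at \<phi> within {-pi..pi})"
      "((\<lambda>\<phi>. - cos (of_int k * \<phi>) / of_int k) has_real_derivative sin (of_int k * \<phi>)) (at \<phi> within {-pi..pi})"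
      using False by (auto intro!: derivative_eq_intros)
    then show "(?F has_vector_derivative cis (of_int k * \<phi>)) (at \<phi> within {-pi..pi})"
      by (simp add: has_vector_derivative_complex_iff has_real_derivative_iff_has_vector_derivative)
  qed (auto intro!: continuous_intros)
  also have "\<dots> = 0" using sin_npi_int[of k] by (simp add: complex_eq_iff mult.commute)
  finally show ?thesis using False by simp
qed

text \<open>The sign from the reflection rule for negative orders is absorbed here, so for both
  signs of \<open>m\<close> the harmonic is this real factor times
  \<open>cis (of_int m * \<phi>)\<close>.\<close>

definition Ylm_polar :: "nat \<Rightarrow> int \<Rightarrow> real \<Rightarrow> real" where
  "Ylm_polar l m t = (if m \<ge> 0 then 1 else (-1) ^ nat \<bar>m\<bar>) *
     (sqrt ((2 * real l + 1) / (4 * pi) * (fact (l - nat \<bar>m\<bar>) / fact (l + nat \<bar>m\<bar>)))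
        * assoc_legendre l (nat \<bar>m\<bar>) t)"

lemma Ylm_angles_eq: "Ylm_angles l m \<theta> \<phi> = of_real (Ylm_polar l m (cos \<theta>)) * cis (of_int m * \<phi>)"
  by (cases "m \<ge> 0") (simp_all add: Ylm_angles_def Ylm_nonneg_def Ylm_polar_def cis_cnj)

text \<open>As the orders agree, the reflection sign and the Condon-Shortley phase occur squared;
  the square roots combine because \<open>1 - t\<^sup>2\<close> is nonnegative.\<close>

lemma Ylm_polar_mult:
  assumes "\<bar>t\<bar> \<le> 1"
  shows "Ylm_polar l m t * Ylm_polar l' m t =
      sqrt ((2 * real l + 1) / (4 * pi) * (fact (l - nat \<bar>m\<bar>) / fact (l + nat \<bar>m\<bar>)))
      * sqrt ((2 * real l' + 1) / (4 * pi) * (fact (l' - nat \<bar>m\<bar>) / fact (l' + nat \<bar>m\<bar>)))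
      * ((1 - t\<^sup>2) ^ nat \<bar>m\<bar> * poly (legendre_deriv l (nat \<bar>m\<bar>)) t * poly (legendre_deriv l' (nat \<bar>m\<bar>)) t)"
proof -
  define e :: real where "e = (-1) ^ nat \<bar>m\<bar>"
  define s where "s = (if m \<ge> 0 then 1 else e)"
  define r where "r = sqrt (1 - t\<^sup>2) ^ nat \<bar>m\<bar>"
  have "s * s = 1" "e * e = 1"
    by (auto simp: s_def e_def simp flip: power_mult_distrib)
  moreover have "t\<^sup>2 \<le> 1" using assms by (simp add: abs_square_le_1)
  then have "r * r = (1 - t\<^sup>2) ^ nat \<bar>m\<bar>"
    by (simp add: r_def flip: power_mult_distrib)
  moreover have "(s * (a * (e * r * p))) * (s * (b * (e * r * q))) = (s * s) * (e * e) * (a * b * ((r * r) * p * q))"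
    for a b p q :: real by (simp add: mult_ac)
  ultimately show ?thesis
    unfolding Ylm_polar_def assoc_legendre_def e_def[symmetric] s_def[symmetric] r_def[symmetric]
    by (simp only: mult_1_left)
qed

lemma sum_symmetric_int_interval:
  fixes f :: "nat \<Rightarrow> real"
  shows "(\<Sum>m=-int l..int l. f (nat \<bar>m\<bar>)) = f 0 + 2 * (\<Sum>m=1..l. f m)"
proof (induction l)
  case (Suc l)
  have "{-int (Suc l)..int (Suc l)} = insert (int (Suc l)) (insert (- int (Suc l)) {-int l..int l})"
    by auto
  then show ?case using Suc by (simp add: nat_add_distrib algebra_simps)
qed simp

text \<open>The diagonal case of the addition theorem for spherical harmonics.\<close>

lemma sum_cmod_Ylm_squared: "(\<Sum>m=-int l..int l. (cmod (Ylm l m x))\<^sup>2) = (2 * real l + 1) / (4 * pi)"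
proof -
  \<comment> \<open>As a cosine, \<open>t\<close> lies between -1 and 1 for every \<open>x\<close>,
    on the sphere or off it.\<close>
  define t where "t = cos (arccos (x $ 3))"
  have t: "\<bar>t\<bar> \<le> 1" by (simp add: t_def)
  let ?w = "\<lambda>m. fact (l - m) / fact (l + m) * (1 - t\<^sup>2) ^ m * (poly (legendre_deriv l m) t)\<^sup>2"
  have "(cmod (Ylm l m x))\<^sup>2 = (2 * real l + 1) / (4 * pi) * ?w (nat \<bar>m\<bar>)" for m
  proof -
    have "(cmod (Ylm l m x))\<^sup>2 = Ylm_polar l m t * Ylm_polar l m t"
      unfolding Ylm_def Ylm_angles_eq t_def by (simp add: norm_mult power2_eq_square)
    also have "\<dots> = (2 * real l + 1) / (4 * pi) * ?w (nat \<bar>m\<bar>)"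
      unfolding Ylm_polar_mult[OF t] real_sqrt_mult_self by (simp add: power2_eq_square)
    finally show ?thesis .
  qed
  then have "(\<Sum>m=-int l..int l. (cmod (Ylm l m x))\<^sup>2) = (2 * real l + 1) / (4 * pi) * (\<Sum>m=-int l..int l. ?w (nat \<bar>m\<bar>))"
    by (simp only: sum_distrib_left)
  also have "(\<Sum>m=-int l..int l. ?w (nat \<bar>m\<bar>)) = ?w 0 + 2 * (\<Sum>m=1..l. ?w m)"
    by (rule sum_symmetric_int_interval)
  also have "\<dots> = 1"
    using legendre_sum_squares[of l t] by simp
  finally show ?thesis by simp
qed

text \<open>The jump of \<open>Arg\<close> disappears: with
  \<open>z = Complex (x $ 1) (x $ 2)\<close>, the product of \<open>cmod z ^ k\<close> and
  \<open>cis (real k * Arg z)\<close> is \<open>z ^ k\<close>. Up to sign and conjugation the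
  harmonic is therefore a polynomial in the coordinates, at the poles too.\<close>

lemma continuous_on_Ylm: "continuous_on S2 (Ylm l m)"
proof -
  have eq: "Ylm_nonneg l k (arccos (x $ 3)) (Arg (Complex (x $ 1) (x $ 2)))
      = complex_of_real (sqrt ((2 * real l + 1) / (4 * pi) * (fact (l - k) / fact (l + k))) * (-1) ^ k
          * poly (legendre_deriv l k) (x $ 3)) * Complex (x $ 1) (x $ 2) ^ k" if "x \<in> S2" for x k
  proof -
    define z where "z = Complex (x $ 1) (x $ 2)"
    have "(norm x)\<^sup>2 = (x $ 1)\<^sup>2 + (x $ 2)\<^sup>2 + (x $ 3)\<^sup>2"
      unfolding power2_norm_eq_inner by (simp add: inner_vec_def sum_3 power2_eq_square)
    then have 1: "(x $ 1)\<^sup>2 + (x $ 2)\<^sup>2 + (x $ 3)\<^sup>2 = 1" using that by simp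
    then have "(x $ 3)\<^sup>2 \<le> 1" using zero_le_power2[of "x $ 1"] zero_le_power2[of "x $ 2"] by linarith
    then have c: "cos (arccos (x $ 3)) = x $ 3" by (intro cos_arccos_abs) (simp add: abs_square_le_1)
    have "1 - (x $ 3)\<^sup>2 = (x $ 1)\<^sup>2 + (x $ 2)\<^sup>2" using 1 by linarith
    then have r: "sqrt (1 - (x $ 3)\<^sup>2) = cmod z" by (simp add: z_def cmod_def)
    have "complex_of_real (cmod z) ^ k * cis (real k * Arg z) = (of_real (cmod z) * cis (Arg z)) ^ k"
      by (simp add: power_mult_distrib Complex.DeMoivre)
    also have "of_real (cmod z) * cis (Arg z) = z" using rcis_cmod_Arg[of z] by (simp add: rcis_def)
    finally have "complex_of_real (cmod z) ^ k * cis (real k * Arg z) = z ^ k" .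
    then show ?thesis
      unfolding Ylm_nonneg_def assoc_legendre_def c r z_def[symmetric] by (simp add: mult_ac)
  qed
  have nonneg: "continuous_on S2 (\<lambda>x. Ylm_nonneg l k (arccos (x $ 3)) (Arg (Complex (x $ 1) (x $ 2))))" for k
    by (subst continuous_on_cong[OF refl eq]) (auto simp: Complex_eq intro!: continuous_intros)
  show ?thesis
    unfolding Ylm_def Ylm_angles_def
    by (cases "m \<ge> 0") (auto intro!: nonneg continuous_intros)
qed

interpretation surface_measure: finite_measure surface_measure
  by (rule finite_measureI) (simp add: space_surface_measure emeasure_surface_measure)

lemma measurable_Ylm [measurable]: "Ylm l m \<in> borel_measurable surface_measure"
  using borel_measurable_continuous_on_restrict[OF continuous_on_Ylm]
  by (simp add: measurable_cong_sets[OF sets_surface_measure refl])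

lemma cmod_Ylm_squared_le:
  assumes "m \<in> {-int l..int l}"
  shows "(cmod (Ylm l m x))\<^sup>2 \<le> (2 * real l + 1) / (4 * pi)"
  unfolding sum_cmod_Ylm_squared[of l x, symmetric] using assms
  by (intro member_le_sum) auto

lemma square_integrable_Ylm:
  assumes "m \<in> {-int l..int l}"
  shows "square_integrable surface_measure (Ylm l m)"
  using cmod_Ylm_squared_le[OF assms]
  by (intro square_integrable_bound[of _ "\<lambda>x. (2 * real l + 1) / (4 * pi)"]) auto

lemma integral_surface_measure:
  fixes f :: "real^3 \<Rightarrow> complex"
  assumes [measurable]: "f \<in> borel_measurable surface_measure"
  shows "(\<integral>x. f x \<partial>surface_measure)
       = (\<integral>p. indicator ({0..pi} \<times> {-pi..pi}) p *\<^sub>R (sin (fst p) *\<^sub>R f (sph_point (fst p) (snd p))) \<partial>lborel)"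
proof -
  let ?B = "{0..pi} \<times> {-pi..pi} :: (real \<times> real) set"
  let ?R = "restrict_space lborel ?B"
  let ?S = "\<lambda>(\<theta>, \<phi>). sph_point \<theta> \<phi>"
  have B: "?B \<in> sets lborel" by (simp add: borel_closed closed_Times)
  have S: "?S \<in> ?R \<rightarrow>\<^sub>M restrict_space borel S2"
    by (rule measurable_restrict_space1) (use measurable_sph_point in simp)
  have sin: "(\<lambda>p. sin (fst p)) \<in> borel_measurable ?R"
    by (intro measurable_restrict_space1) (auto simp flip: lborel_prod)
  have f: "f \<in> borel_measurable (restrict_space borel S2)"
    using assms by (simp add: measurable_cong_sets[OF sets_surface_measure refl])
  have fS: "(\<lambda>p. f (?S p)) \<in> borel_measurable ?R" by (rule measurable_compose[OF S f])
  have nn: "AE p in ?R. 0 \<le> sin (fst p)"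
    by (rule AE_I2) (auto simp: space_restrict_space sin_ge_zero)
  have "(\<integral>x. f x \<partial>surface_measure) = (\<integral>p. f (?S p) \<partial>density ?R (\<lambda>p. ennreal (sin (fst p))))"
    unfolding surface_measure_def case_prod_beta'
    by (rule integral_distr) (use S f in \<open>simp_all add: case_prod_beta'\<close>)
  also have "\<dots> = (\<integral>p. sin (fst p) *\<^sub>R f (?S p) \<partial>?R)"
    by (rule integral_density[OF fS sin nn])
  also have "\<dots> = (\<integral>p. indicator ?B p *\<^sub>R (sin (fst p) *\<^sub>R f (?S p)) \<partial>lborel)"
    by (rule integral_restrict_space) (use B in simp)
  finally show ?thesis by (simp add: case_prod_beta')
qed

text \<open>\<open>Arg\<close> never takes the value \<open>-pi\<close>, while the parameter
  rectangle is closed there. Longitudes \<open>-pi\<close> and \<open>pi\<close> give the same point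
  and the same exponential, so the formula covers the whole rectangle.\<close>

lemma Ylm_sph_point_polar:
  assumes "\<theta> \<in> {0..pi}" "\<phi> \<in> {-pi..pi}"
  shows "Ylm l m (sph_point \<theta> \<phi>) = of_real (Ylm_polar l m (cos \<theta>)) * cis (of_int m * \<phi>)"
proof (cases "\<phi> = -pi")
  case True
  have "sph_point \<theta> \<phi> = sph_point \<theta> pi" by (simp add: True sph_point_def)
  moreover have "cis (of_int m * \<phi>) = cis (of_int m * pi)"
    using sin_npi_int[of m] by (simp add: True complex_eq_iff mult.commute)
  moreover have "Ylm l m (sph_point \<theta> pi) = Ylm_angles l m \<theta> pi"
    by (rule Ylm_sph_point) (use assms in auto)
  ultimately show ?thesis by (simp add: Ylm_angles_eq)
qed (use assms in \<open>simp add: Ylm_sph_point Ylm_angles_eq\<close>)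

lemma continuous_on_Ylm_polar: "continuous_on UNIV (Ylm_polar l m)"
  unfolding Ylm_polar_def assoc_legendre_def by (intro continuous_intros)

text \<open>In spherical coordinates the integral factors. The azimuthal factor is
  \<open>2 * pi\<close> or 0 according to whether the orders agree; for equal orders the polar
  factor is a multiple of \<open>legendre_inner\<close>.\<close>

lemma Ylm_orthonormal:
  assumes m: "m \<in> {-int l..int l}" and m': "m' \<in> {-int l'..int l'}"
  shows "(\<integral>x. Ylm l m x * cnj (Ylm l' m' x) \<partial>surface_measure) = (if l = l' \<and> m = m' then 1 else 0)"
proof -
  let ?p = "\<lambda>t. Ylm_polar l m t * Ylm_polar l' m' t"
  let ?a = "\<lambda>\<theta>. indicator {0..pi} \<theta> *\<^sub>R (sin \<theta> * ?p (cos \<theta>)) :: real"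
  let ?b = "\<lambda>\<phi>. indicator {-pi..pi} \<phi> *\<^sub>R cis (of_int (m - m') * \<phi>)"
  have a: "integrable lborel ?a"
    by (intro polar_integrable continuous_intros continuous_on_Ylm_polar)
  have b: "integrable lborel ?b"
  proof -
    have "continuous_on {-pi..pi} (\<lambda>\<phi>. cis (of_int (m - m') * \<phi>))" by (intro continuous_intros)
    from borel_integrable_atLeastAtMost'[OF this] show ?thesis by (simp add: set_integrable_def)
  qed
  have meas: "(\<lambda>x. Ylm l m x * cnj (Ylm l' m' x)) \<in> borel_measurable surface_measure"
    by (intro borel_measurable_times measurable_Ylm
        measurable_compose[OF measurable_Ylm borel_measurable_continuous_onI] continuous_intros)
  have "(\<integral>x. Ylm l m x * cnj (Ylm l' m' x) \<partial>surface_measure)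
      = (\<integral>p. complex_of_real (?a (fst p)) * ?b (snd p) \<partial>lborel)"
    unfolding integral_surface_measure[OF meas]
  proof (intro Bochner_Integration.integral_cong refl)
    fix p :: "real \<times> real"
    show "indicator ({0..pi} \<times> {-pi..pi}) p *\<^sub>R (sin (fst p) *\<^sub>R
          (Ylm l m (sph_point (fst p) (snd p)) * cnj (Ylm l' m' (sph_point (fst p) (snd p)))))
        = complex_of_real (?a (fst p)) * ?b (snd p)"
    proof (cases "fst p \<in> {0..pi} \<and> snd p \<in> {-pi..pi}")
      case True
      have "cis (of_int (m - m') * snd p) = cis (of_int m * snd p) * cnj (cis (of_int m' * snd p))"
        by (simp add: cis_cnj cis_mult left_diff_distrib)
      then show ?thesis
        using True by (simp add: Ylm_sph_point_polar indicator_times scaleR_conv_of_real mult_ac)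
    qed (auto simp: indicator_def mem_Times_iff)
  qed
  also have "\<dots> = complex_of_real (polar_integral ?p) * (\<integral>\<phi>. ?b \<phi> \<partial>lborel)"
    using lborel_pair.integral_mult_pair[of "\<lambda>\<theta>. complex_of_real (?a \<theta>)" ?b, OF integrable_of_real[OF a] b]
    unfolding lborel_prod polar_integral_def integral_complex_of_real .
  finally have *: "(\<integral>x. Ylm l m x * cnj (Ylm l' m' x) \<partial>surface_measure)
      = (if m = m' then complex_of_real (polar_integral ?p * (2 * pi)) else 0)"
    unfolding integral_cis_int by simp
  show ?thesis
  proof (cases "m = m'")
    case True
    let ?k = "nat \<bar>m\<bar>"
    let ?N = "\<lambda>l. sqrt ((2 * real l + 1) / (4 * pi) * (fact (l - ?k) / fact (l + ?k)))"
    have "polar_integral ?p = polar_integral (\<lambda>t. ?N l * ?N l' *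
        ((1 - t\<^sup>2) ^ ?k * poly (legendre_deriv l ?k) t * poly (legendre_deriv l' ?k) t))"
      unfolding polar_integral_def True[symmetric] by (simp add: Ylm_polar_mult)
    then have p: "polar_integral ?p = ?N l * ?N l' * legendre_inner l l' ?k"
      unfolding polar_integral_cmult legendre_inner_def .
    show ?thesis
    proof (cases "l = l'")
      case False
      then show ?thesis unfolding * p by (simp add: legendre_inner_neq)
    next
      case l: True
      \<comment> \<open>The normalising \<open>4 * pi\<close> against the azimuthal
        \<open>2 * pi\<close> leaves the division by 2, which matches the value in
        \<open>legendre_inner_eq\<close>.\<close>
      have "polar_integral ?p * (2 * pi)
          = ((2 * real l + 1) * (fact (l - ?k) / fact (l + ?k)) * legendre_inner l l ?k) / 2"
        unfolding p unfolding l[symmetric] real_sqrt_mult_self by (simp add: field_simps)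
      also have "\<dots> = 1" using m by (subst legendre_inner_eq) auto
      finally show ?thesis using True l * by simp
    qed
  qed (simp add: *)
qed

section \<open>Isotropic fields\<close>

locale isotropic_field =
  fixes M :: "'w measure" and T :: "'w \<Rightarrow> real^3 \<Rightarrow> real" and C :: "nat \<Rightarrow> real"
  assumes isotropic: "isotropic_random_field M T"
    and spectrum: "angular_power_spectrum M T C"

sublocale isotropic_field \<subseteq> M: prob_space M
  using isotropic by (simp add: isotropic_random_field_def second_order_field_def)

sublocale isotropic_field \<subseteq> pair_sigma_finite M surface_measure ..

context isotropic_field
begin

abbreviation coeff :: "nat \<Rightarrow> int \<Rightarrow> 'w \<Rightarrow> complex" where
  "coeff \<equiv> harmonic_coeff T"

text \<open>On the diagonal the great-circle distance is always \<open>arccos 1\<close>, so isotropy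
  leaves a single value.\<close>

lemma variance_constant: "\<exists>v. \<forall>x\<in>S2. (\<integral>\<omega>. (T \<omega> x)\<^sup>2 \<partial>M) = v"
proof -
  obtain R where R: "\<And>x y. x \<in> S2 \<Longrightarrow> y \<in> S2 \<Longrightarrow> real_field_cov M T x y = R (gc_dist x y)"
    using isotropic by (auto simp: isotropic_random_field_def)
  have "(\<integral>\<omega>. (T \<omega> x)\<^sup>2 \<partial>M) = Re (R (arccos 1))" if "x \<in> S2" for x
  proof -
    have "real_field_cov M T x x = complex_of_real (\<integral>\<omega>. (T \<omega> x)\<^sup>2 \<partial>M)"
      unfolding field_cov_def integral_cmod_squared by simp
    moreover have "gc_dist x x = arccos 1"
      using that by (simp add: gc_dist_def flip: power2_norm_eq_inner)
    ultimately show ?thesis using R[OF that that] by (metis Re_complex_of_real)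
  qed
  then show ?thesis by blast
qed

text \<open>Tonelli with the probability integral taken first: the inner integral is the constant
  variance, and the sphere has finite area.\<close>

lemma square_integrable_field:
  "square_integrable (M \<Otimes>\<^sub>M surface_measure) (\<lambda>z. complex_of_real (T (fst z) (snd z)))"
proof -
  have meas [measurable]: "(\<lambda>z. T (fst z) (snd z)) \<in> borel_measurable (M \<Otimes>\<^sub>M surface_measure)"
    and int: "\<And>x. x \<in> S2 \<Longrightarrow> integrable M (\<lambda>\<omega>. (T \<omega> x)\<^sup>2)"
    using isotropic by (auto simp: isotropic_random_field_def second_order_field_def case_prod_beta')
  obtain v where v: "\<And>x. x \<in> S2 \<Longrightarrow> (\<integral>\<omega>. (T \<omega> x)\<^sup>2 \<partial>M) = v"
    using variance_constant by blast
  have "(\<integral>\<^sup>+z. ennreal ((T (fst z) (snd z))\<^sup>2) \<partial>(M \<Otimes>\<^sub>M surface_measure))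
      = (\<integral>\<^sup>+x. (\<integral>\<^sup>+\<omega>. ennreal ((T \<omega> x)\<^sup>2) \<partial>M) \<partial>surface_measure)"
    by (subst nn_integral_snd[symmetric]) auto
  also have "\<dots> = (\<integral>\<^sup>+x. ennreal v \<partial>surface_measure)"
  proof (intro nn_integral_cong)
    fix x assume "x \<in> space surface_measure"
    then have "x \<in> S2" by (simp add: space_surface_measure)
    then show "(\<integral>\<^sup>+\<omega>. ennreal ((T \<omega> x)\<^sup>2) \<partial>M) = ennreal v"
      using int v by (subst nn_integral_eq_integral) auto
  qed
  also have "\<dots> < \<infinity>"
    by (simp add: emeasure_surface_measure space_surface_measure ennreal_mult_less_top)
  finally have "integrable (M \<Otimes>\<^sub>M surface_measure) (\<lambda>z. (T (fst z) (snd z))\<^sup>2)"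
    unfolding integrable_iff_bounded by simp
  then show ?thesis by (simp add: square_integrable_def)
qed

section \<open>Moments of the harmonic coefficients\<close>

lemma square_integrable_coeff:
  assumes "m \<in> {-int l..int l}"
  shows "square_integrable M (coeff l m)"
  using square_integrable_integral_section[OF square_integrable_field
      square_integrable_cnj[OF square_integrable_Ylm[OF assms]]]
  by (simp add: harmonic_coeff_def[abs_def])

text \<open>Fubini exchanges expectation and surface integral, and the field has mean zero at every
  point.\<close>

lemma integral_coeff:
  assumes m: "m \<in> {-int l..int l}"
  shows "(\<integral>\<omega>. coeff l m \<omega> \<partial>M) = 0"
proof -
  have "square_integrable M (\<lambda>_. 1)" by (simp add: square_integrable_def)
  from square_integrable_mult_pair[OF this square_integrable_cnj[OF square_integrable_Ylm[OF m]]]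
  have "square_integrable (M \<Otimes>\<^sub>M surface_measure) (\<lambda>z. cnj (Ylm l m (snd z)))" by simp
  from integrable_mult_square_integrable[OF square_integrable_field this]
  have "integrable (M \<Otimes>\<^sub>M surface_measure) (\<lambda>(\<omega>, x). complex_of_real (T \<omega> x) * cnj (Ylm l m x))"
    by (simp add: case_prod_beta')
  from Fubini_integral[OF this]
  have "(\<integral>\<omega>. coeff l m \<omega> \<partial>M) = (\<integral>x. (\<integral>\<omega>. complex_of_real (T \<omega> x) * cnj (Ylm l m x) \<partial>M) \<partial>surface_measure)"
    by (simp add: harmonic_coeff_def)
  also have "\<dots> = (\<integral>x. 0 \<partial>surface_measure)"
    using isotropic
    by (intro Bochner_Integration.integral_cong)
       (auto simp: isotropic_random_field_def zero_mean_field_def space_surface_measure)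
  finally show ?thesis by simp
qed

lemma integral_coeff_mult_cnj:
  assumes "m \<in> {-int l..int l}" "m' \<in> {-int l'..int l'}"
  shows "(\<integral>\<omega>. coeff l m \<omega> * cnj (coeff l' m' \<omega>) \<partial>M) = (if l = l' \<and> m = m' then complex_of_real (C l) else 0)"
  using spectrum assms by (simp add: angular_power_spectrum_def)

text \<open>\<open>C l\<close> is the second moment of the coefficient of order 0, which exists in
  every degree.\<close>

lemma spectrum_nonneg: "C l \<ge> 0"
proof -
  have "complex_of_real (\<integral>\<omega>. (cmod (coeff l 0 \<omega>))\<^sup>2 \<partial>M) = complex_of_real (C l)"
    unfolding integral_cmod_squared[symmetric] using integral_coeff_mult_cnj[of 0 l 0 l] by simp
  then show ?thesis by (metis of_real_eq_iff integral_nonneg_AE AE_I2 zero_le_power2)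
qed

lemma sum_delta_blocks:
  fixes c d :: "int \<Rightarrow> complex"
  shows "(\<Sum>m=-int l..int l. \<Sum>m'=-int l'..int l'. c m * cnj (d m') * (if l = l' \<and> m = m' then e else 0))
       = (if l = l' then e * (\<Sum>m=-int l..int l. c m * cnj (d m)) else 0)"
  by (auto simp: sum_distrib_left if_distrib[of "\<lambda>x. _ * x"] mult_ac cong: if_cong)

text \<open>Uncorrelated coefficients reduce the double sum to its diagonal. With conjugated kernel
  coefficients times harmonics as weights, this yields the terms of the covariance function.\<close>

lemma integral_coeff_block_mult_cnj:
  "(\<integral>\<omega>. (\<Sum>m=-int l..int l. c m * coeff l m \<omega>) * cnj (\<Sum>m=-int l'..int l'. d m * coeff l' m \<omega>) \<partial>M)
     = (if l = l' then complex_of_real (C l) * (\<Sum>m=-int l..int l. c m * cnj (d m)) else 0)"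
proof -
  have "(\<integral>\<omega>. (\<Sum>m=-int l..int l. c m * coeff l m \<omega>) * cnj (\<Sum>m=-int l'..int l'. d m * coeff l' m \<omega>) \<partial>M)
      = (\<Sum>m=-int l..int l. \<Sum>m'=-int l'..int l'. \<integral>\<omega>. c m * coeff l m \<omega> * cnj (d m' * coeff l' m' \<omega>) \<partial>M)"
    by (intro integral_mult_cnj_sum square_integrable_cmult square_integrable_coeff) auto
  also have "\<dots> = (\<Sum>m=-int l..int l. \<Sum>m'=-int l'..int l'. c m * cnj (d m') *
      (if l = l' \<and> m = m' then complex_of_real (C l) else 0))"
  proof (intro sum.cong refl)
    fix m m' assume "m \<in> {-int l..int l}" "m' \<in> {-int l'..int l'}"
    then have "c m * cnj (d m') * (\<integral>\<omega>. coeff l m \<omega> * cnj (coeff l' m' \<omega>) \<partial>M)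
        = c m * cnj (d m') * (if l = l' \<and> m = m' then complex_of_real (C l) else 0)"
      by (simp only: integral_coeff_mult_cnj)
    then show "(\<integral>\<omega>. c m * coeff l m \<omega> * cnj (d m' * coeff l' m' \<omega>) \<partial>M)
        = c m * cnj (d m') * (if l = l' \<and> m = m' then complex_of_real (C l) else 0)"
      by (subst (asm) integral_mult_right_zero[symmetric]) (simp add: mult_ac)
  qed
  also note sum_delta_blocks
  finally show ?thesis .
qed

section \<open>Degree-wise expansions on the product space\<close>

text \<open>Weights 1 give the degree-\<open>l\<close> part of the expansion of the field itself,
  and \<open>c l m = Ylm l m x\<close> gives the translation term at \<open>x\<close>, so one
  computation covers both.\<close>

definition block :: "(nat \<Rightarrow> int \<Rightarrow> complex) \<Rightarrow> nat \<Rightarrow> 'w \<times> (real^3) \<Rightarrow> complex" where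
  "block c l z = (\<Sum>m=-int l..int l. (c l m * coeff l m (fst z)) * Ylm l m (snd z))"

lemma square_integrable_block_term:
  assumes "m \<in> {-int l..int l}"
  shows "square_integrable (M \<Otimes>\<^sub>M surface_measure) (\<lambda>z. (c l m * coeff l m (fst z)) * Ylm l m (snd z))"
  using square_integrable_mult_pair[OF square_integrable_cmult[OF square_integrable_coeff[OF assms]]
      square_integrable_Ylm[OF assms]] .

lemma square_integrable_block: "square_integrable (M \<Otimes>\<^sub>M surface_measure) (block c l)"
  unfolding block_def by (intro square_integrable_sum square_integrable_block_term)

text \<open>Each mixed term factors into a covariance of coefficients and an inner product of
  harmonics, both of which vanish off the diagonal.\<close>

lemma integral_block_mult_cnj:
  "(\<integral>z. block c l z * cnj (block c l' z) \<partial>(M \<Otimes>\<^sub>M surface_measure))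
     = (if l = l' then complex_of_real (C l * (\<Sum>m=-int l..int l. (cmod (c l m))\<^sup>2)) else 0)"
proof -
  have "(\<integral>z. block c l z * cnj (block c l' z) \<partial>(M \<Otimes>\<^sub>M surface_measure))
      = (\<Sum>m=-int l..int l. \<Sum>m'=-int l'..int l'.
          \<integral>z. ((c l m * coeff l m (fst z)) * Ylm l m (snd z)) *
            cnj ((c l' m' * coeff l' m' (fst z)) * Ylm l' m' (snd z)) \<partial>(M \<Otimes>\<^sub>M surface_measure))"
    unfolding block_def by (intro integral_mult_cnj_sum square_integrable_block_term) auto
  also have "\<dots> = (\<Sum>m=-int l..int l. \<Sum>m'=-int l'..int l'. c l m * cnj (c l' m') *
      (if l = l' \<and> m = m' then complex_of_real (C l) else 0))"
  proof (intro sum.cong refl)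
    fix m m' assume m: "m \<in> {-int l..int l}" "m' \<in> {-int l'..int l'}"
    have a: "integrable M (\<lambda>\<omega>. coeff l m \<omega> * cnj (coeff l' m' \<omega>))"
      using m by (intro integrable_mult_square_integrable square_integrable_cnj square_integrable_coeff)
    have y: "integrable surface_measure (\<lambda>x. Ylm l m x * cnj (Ylm l' m' x))"
      using m by (intro integrable_mult_square_integrable square_integrable_cnj square_integrable_Ylm)
    have "(\<lambda>z. ((c l m * coeff l m (fst z)) * Ylm l m (snd z)) *
            cnj ((c l' m' * coeff l' m' (fst z)) * Ylm l' m' (snd z)))
        = (\<lambda>z. (c l m * cnj (c l' m')) * ((coeff l m (fst z) * cnj (coeff l' m' (fst z)))
            * (Ylm l m (snd z) * cnj (Ylm l' m' (snd z)))))"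
      by (simp add: fun_eq_iff mult_ac)
    then show "(\<integral>z. ((c l m * coeff l m (fst z)) * Ylm l m (snd z)) *
            cnj ((c l' m' * coeff l' m' (fst z)) * Ylm l' m' (snd z)) \<partial>(M \<Otimes>\<^sub>M surface_measure))
        = c l m * cnj (c l' m') * (if l = l' \<and> m = m' then complex_of_real (C l) else 0)"
      using m by (simp only: integral_mult_right_zero integral_mult_pair[OF a y] integral_coeff_mult_cnj
          Ylm_orthonormal) simp
  qed
  also have "\<dots> = (if l = l' then complex_of_real (C l) * (\<Sum>m=-int l..int l. c l m * cnj (c l m)) else 0)"
    using sum_delta_blocks[where c = "c l" and d = "c l'" and l = l and l' = l'] by auto
  finally show ?thesis by (simp add: complex_norm_square flip: of_real_power)
qed

lemma integral_cmod_block_squared: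
  "(\<integral>z. (cmod (block c l z))\<^sup>2 \<partial>(M \<Otimes>\<^sub>M surface_measure)) = C l * (\<Sum>m=-int l..int l. (cmod (c l m))\<^sup>2)"
  using integral_block_mult_cnj[of c l l] by (simp only: integral_cmod_squared if_True simp_thms of_real_eq_iff)

text \<open>Integrating over the sphere first turns the field into its coefficient, so every order
  contributes \<open>C l\<close>. This is the projection property that Bessel's inequality asks
  for.\<close>

lemma integral_field_mult_cnj_block:
  "(\<integral>z. complex_of_real (T (fst z) (snd z)) * cnj (block (\<lambda>_ _. 1) l z) \<partial>(M \<Otimes>\<^sub>M surface_measure))
     = complex_of_real (C l * (2 * real l + 1))"
proof -
  let ?e = "\<lambda>m z. (1 * coeff l m (fst z)) * Ylm l m (snd z)"
  let ?T = "\<lambda>z. complex_of_real (T (fst z) (snd z))"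
  have "(\<integral>z. ?T z * cnj (block (\<lambda>_ _. 1) l z) \<partial>(M \<Otimes>\<^sub>M surface_measure))
      = (\<integral>z. (\<Sum>i\<in>{()}. ?T z) * cnj (\<Sum>m=-int l..int l. ?e m z) \<partial>(M \<Otimes>\<^sub>M surface_measure))"
    by (simp add: block_def)
  also have "\<dots> = (\<Sum>i\<in>{()}. \<Sum>m=-int l..int l. \<integral>z. ?T z * cnj (?e m z) \<partial>(M \<Otimes>\<^sub>M surface_measure))"
    by (intro integral_mult_cnj_sum square_integrable_field square_integrable_block_term) auto
  also have "\<dots> = (\<Sum>m=-int l..int l. complex_of_real (C l))"
  proof (simp only: sum.insert sum.empty finite.emptyI empty_iff not_False_eq_True add_0_right, intro sum.cong refl)
    fix m assume m: "m \<in> {-int l..int l}"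
    have "integrable (M \<Otimes>\<^sub>M surface_measure) (\<lambda>z. ?T z * cnj (?e m z))"
      using m by (intro integrable_mult_square_integrable square_integrable_cnj
          square_integrable_field square_integrable_block_term)
    from integral_fst'[OF this]
    have "(\<integral>z. ?T z * cnj (?e m z) \<partial>(M \<Otimes>\<^sub>M surface_measure))
        = (\<integral>\<omega>. (\<integral>x. cnj (coeff l m \<omega>) * (complex_of_real (T \<omega> x) * cnj (Ylm l m x)) \<partial>surface_measure) \<partial>M)"
      by (simp add: mult_ac)
    also have "\<dots> = (\<integral>\<omega>. coeff l m \<omega> * cnj (coeff l m \<omega>) \<partial>M)"
      unfolding integral_mult_right_zero harmonic_coeff_def by (simp add: mult_ac)
    finally show "(\<integral>z. ?T z * cnj (?e m z) \<partial>(M \<Otimes>\<^sub>M surface_measure)) = complex_of_real (C l)"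
      using m by (simp add: integral_coeff_mult_cnj)
  qed
  finally show ?thesis by (simp add: mult_ac)
qed

text \<open>Because the coefficients are uncorrelated, the blocks with \<open>c = 1\<close> are orthogonal in \<open>L\<^sup>2\<close> of the
  product space; Bessel's inequality for the field then bounds the partial sums.\<close>

lemma summable_spectrum: "summable (\<lambda>l. C l * (2 * real l + 1))"
proof (rule summableI_nonneg_bounded)
  fix n
  have *: "(\<Sum>m=-int l..int l. (cmod 1)\<^sup>2) = 2 * real l + 1" for l by simp
  have "(\<Sum>l<n. \<integral>z. (cmod (block (\<lambda>_ _. 1) l z))\<^sup>2 \<partial>(M \<Otimes>\<^sub>M surface_measure))
      \<le> (\<integral>z. (cmod (complex_of_real (T (fst z) (snd z))))\<^sup>2 \<partial>(M \<Otimes>\<^sub>M surface_measure))"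
    by (rule bessel_square_integrable)
       (simp_all only: square_integrable_field square_integrable_block integral_block_mult_cnj
          integral_field_mult_cnj_block * if_True if_False simp_thms)
  then show "(\<Sum>l<n. C l * (2 * real l + 1))
      \<le> (\<integral>z. (cmod (complex_of_real (T (fst z) (snd z))))\<^sup>2 \<partial>(M \<Otimes>\<^sub>M surface_measure))"
    by (simp only: integral_cmod_block_squared *)
qed (simp add: spectrum_nonneg)

text \<open>\<open>L2_suminf\<close> is a choice, so it suffices that some sum exists. The terms are
  orthogonal blocks whose squared norms \<open>C l * (2 * l + 1) / (4 * pi)\<close> are
  summable.\<close>

lemma L2_sums_translation:
  "L2_sums (M \<Otimes>\<^sub>M surface_measure) (translation_term T x) (spherical_translation M T x)"
proof -
  interpret P: finite_measure "M \<Otimes>\<^sub>M surface_measure"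
    by (intro finite_measure_pair_measure surface_measure.finite_measure_axioms M.finite_measure_axioms)
  have eq: "translation_term T x = block (\<lambda>l m. Ylm l m x)"
    by (simp add: translation_term_def block_def fun_eq_iff mult_ac)
  have "summable (\<lambda>l. C l * (2 * real l + 1) / (4 * pi))"
    using summable_spectrum by (rule summable_divide)
  then have "\<exists>s. L2_sums (M \<Otimes>\<^sub>M surface_measure) (translation_term T x) s"
    unfolding eq
    by (intro P.L2_sums_exists)
       (simp_all add: square_integrable_block integral_block_mult_cnj integral_cmod_block_squared
          sum_cmod_Ylm_squared)
  then show ?thesis
    unfolding spherical_translation_def L2_suminf_def by (rule someI_ex)
qed

end

section \<open>Kernel coefficients and the convolution\<close>

text \<open>Pairing the expansion with one harmonic leaves a single term by orthonormality, so the
  given \<open>h\<close> are the Fourier coefficients of \<open>f\<close>.\<close>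

lemma L2_sums_Ylm_imp_coeff:
  assumes f: "L2_sums surface_measure (\<lambda>l x. \<Sum>m=-int l..int l. h l m * Ylm l m x) f"
    and m: "m \<in> {-int l..int l}"
  shows "(\<integral>x. f x * cnj (Ylm l m x) \<partial>surface_measure) = h l m"
proof -
  have Y: "square_integrable surface_measure (\<lambda>x. cnj (Ylm l m x))"
    using m by (intro square_integrable_cnj square_integrable_Ylm)
  have "(\<integral>x. (\<Sum>m'=-int k..int k. h k m' * Ylm k m' x) * cnj (Ylm l m x) \<partial>surface_measure)
      = (if k = l then h k m else 0)" for k
  proof -
    have "(\<integral>x. (\<Sum>m'=-int k..int k. h k m' * Ylm k m' x) * cnj (Ylm l m x) \<partial>surface_measure)
        = (\<Sum>m'=-int k..int k. h k m' * (\<integral>x. Ylm k m' x * cnj (Ylm l m x) \<partial>surface_measure))"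
    proof -
      have "integrable surface_measure (\<lambda>x. Ylm k m' x * cnj (Ylm l m x))" if "m' \<in> {-int k..int k}" for m'
        using that by (intro integrable_mult_square_integrable square_integrable_Ylm Y)
      then show ?thesis by (simp add: sum_distrib_right mult.assoc)
    qed
    also have "\<dots> = (\<Sum>m'=-int k..int k. if m' = m then (if k = l then h k m else 0) else 0)"
      using m by (intro sum.cong refl) (auto simp: Ylm_orthonormal)
    also have "\<dots> = (if k = l then h k m else 0)" using m by auto
    finally show ?thesis .
  qed
  then have "(\<lambda>k. if k = l then h k m else 0) sums (\<integral>x. f x * cnj (Ylm l m x) \<partial>surface_measure)"
    using L2_sums_imp_sums_integral_mult[OF f Y] by simp
  moreover have "(\<lambda>k. if k = l then h k m else 0) sums h l m" by (rule sums_single)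
  ultimately show ?thesis by (rule sums_unique2)
qed

context isotropic_field
begin

lemma L2_sums_sifting_convolution:
  assumes H: "square_integrable surface_measure (\<lambda>x. complex_of_real (H x))"
    and h: "L2_sums surface_measure (\<lambda>l x. \<Sum>m=-int l..int l. h l m * Ylm l m x) (\<lambda>x. complex_of_real (H x))"
  shows "L2_sums M (\<lambda>l \<omega>. \<Sum>m=-int l..int l. sifting_coeff T h l m \<omega> * Ylm l m x)
     (\<lambda>\<omega>. sifting_convolution M T H \<omega> x)"
proof -
  \<comment> \<open>The kernel is real, so this integral is the conjugate of its Fourier
    coefficient; this is where the conjugate of \<open>h\<close> comes from.\<close>
  have YH: "(\<integral>x. Ylm l m x * complex_of_real (H x) \<partial>surface_measure) = cnj (h l m)"
    if "m \<in> {-int l..int l}" for l m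
    using cnj_integral_mult_cnj[of surface_measure "\<lambda>x. complex_of_real (H x)" "Ylm l m"]
      L2_sums_Ylm_imp_coeff[OF h that] by simp
  have "(\<integral>x'. translation_term T x l (\<omega>, x') * complex_of_real (H x') \<partial>surface_measure)
      = (\<Sum>m=-int l..int l. sifting_coeff T h l m \<omega> * Ylm l m x)" for l \<omega>
  proof -
    have int: "integrable surface_measure (\<lambda>x'. Ylm l m x' * complex_of_real (H x'))"
      if "m \<in> {-int l..int l}" for m
      using that H by (intro integrable_mult_square_integrable square_integrable_Ylm)
    have "(\<integral>x'. translation_term T x l (\<omega>, x') * complex_of_real (H x') \<partial>surface_measure)
        = (\<integral>x'. (\<Sum>m=-int l..int l. coeff l m \<omega> * Ylm l m x * (Ylm l m x' * complex_of_real (H x'))) \<partial>surface_measure)"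
      by (simp add: translation_term_def sum_distrib_left sum_distrib_right mult_ac)
    also have "\<dots> = (\<Sum>m=-int l..int l. coeff l m \<omega> * Ylm l m x *
          (\<integral>x'. Ylm l m x' * complex_of_real (H x') \<partial>surface_measure))"
      using int by (subst Bochner_Integration.integral_sum) auto
    also have "\<dots> = (\<Sum>m=-int l..int l. sifting_coeff T h l m \<omega> * Ylm l m x)"
      by (intro sum.cong refl) (simp only: YH, simp add: sifting_coeff_def mult_ac)
    finally show ?thesis .
  qed
  then show ?thesis
    using L2_sums_integral_section[OF L2_sums_translation H, of x] by (simp add: sifting_convolution_def)
qed

end

text \<open>Convergence of the spectral series is in mean square at each fixed point, with partial
  sums over whole degrees. The first conjunct certifies that the representative chosen in
  \<open>spherical_translation\<close> is a genuine sum, on which the meaning of the convolution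
  rests.\<close>

theorem theorem12:
  fixes M :: "'w measure"
    and T :: "'w \<Rightarrow> real^3 \<Rightarrow> real"
    and C :: "nat \<Rightarrow> real"
    and H :: "real^3 \<Rightarrow> real"
    and h :: "nat \<Rightarrow> int \<Rightarrow> complex"
  assumes "isotropic_random_field M T"
    and "angular_power_spectrum M T C"
    and "square_integrable surface_measure (\<lambda>x. complex_of_real (H x))"
    and "L2_sums surface_measure (\<lambda>l x. \<Sum>m=-int l..int l. h l m * Ylm l m x)
           (\<lambda>x. complex_of_real (H x))"
  shows "(\<forall>x\<in>S2. L2_sums (M \<Otimes>\<^sub>M surface_measure) (translation_term T x)
                   (spherical_translation M T x)) \<and>
         (\<forall>x\<in>S2. L2_sums M (\<lambda>l \<omega>. \<Sum>m=-int l..int l. sifting_coeff T h l m \<omega> * Ylm l m x)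
                   (\<lambda>\<omega>. sifting_convolution M T H \<omega> x)) \<and>
         (\<forall>l. \<forall>m\<in>{-int l..int l}.
            square_integrable M (sifting_coeff T h l m) \<and>
            (\<integral>\<omega>. sifting_coeff T h l m \<omega> \<partial>M) = 0) \<and>
         (\<forall>l l'. \<forall>m\<in>{-int l..int l}. \<forall>m'\<in>{-int l'..int l'}.
            (\<integral>\<omega>. sifting_coeff T h l m \<omega> * cnj (sifting_coeff T h l' m' \<omega>) \<partial>M) =
            (if l = l' \<and> m = m' then complex_of_real (sifting_spectrum C h l m) else 0)) \<and>
         (\<forall>x\<in>S2. (\<integral>\<omega>. sifting_convolution M T H \<omega> x \<partial>M) = 0) \<and>
         (\<forall>x1\<in>S2. \<forall>x2\<in>S2.
            (\<lambda>l. complex_of_real (C l) *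
                 (\<Sum>m=-int l..int l. complex_of_real ((cmod (h l m))\<^sup>2) * Ylm l m x1 * cnj (Ylm l m x2)))
            sums field_cov M (sifting_convolution M T H) x1 x2)"
proof -
  interpret isotropic_field M T C by unfold_locales (use assms in auto)
  note conv = L2_sums_sifting_convolution[OF assms(3,4)]
  have sq: "square_integrable M (sifting_coeff T h l m)" if "m \<in> {-int l..int l}" for l m
    using square_integrable_cmult[OF square_integrable_coeff[OF that], of "cnj (h l m)"]
    by (simp add: sifting_coeff_def[abs_def] mult.commute)
  have int: "integrable M (sifting_coeff T h l m)" if "m \<in> {-int l..int l}" for l m
    using integrable_mult_square_integrable[OF sq[OF that], of "\<lambda>_. 1"] by (simp add: square_integrable_def)
  have mean: "(\<integral>\<omega>. sifting_coeff T h l m \<omega> \<partial>M) = 0" if "m \<in> {-int l..int l}" for l m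
    using that by (simp add: sifting_coeff_def integral_coeff)
  have cov: "(\<integral>\<omega>. sifting_coeff T h l m \<omega> * cnj (sifting_coeff T h l' m' \<omega>) \<partial>M)
      = (if l = l' \<and> m = m' then complex_of_real (sifting_spectrum C h l m) else 0)"
    if "m \<in> {-int l..int l}" "m' \<in> {-int l'..int l'}" for l l' m m'
  proof -
    have "(\<integral>\<omega>. sifting_coeff T h l m \<omega> * cnj (sifting_coeff T h l' m' \<omega>) \<partial>M)
        = (\<integral>\<omega>. (cnj (h l m) * h l' m') * (coeff l m \<omega> * cnj (coeff l' m' \<omega>)) \<partial>M)"
      by (simp add: sifting_coeff_def mult_ac)
    also have "\<dots> = (cnj (h l m) * h l' m') * (if l = l' \<and> m = m' then complex_of_real (C l) else 0)"
      unfolding integral_mult_right_zero using that by (simp only: integral_coeff_mult_cnj)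
    also have "\<dots> = (if l = l' \<and> m = m' then complex_of_real (sifting_spectrum C h l m) else 0)"
      by (simp add: sifting_spectrum_def complex_norm_square mult_ac flip: of_real_power)
    finally show ?thesis .
  qed
  have conv_mean: "(\<integral>\<omega>. sifting_convolution M T H \<omega> x \<partial>M) = 0" for x
  proof -
    have "(\<integral>\<omega>. (\<Sum>m=-int l..int l. sifting_coeff T h l m \<omega> * Ylm l m x) \<partial>M) = 0" for l
      using int by (subst Bochner_Integration.integral_sum) (auto simp: mean)
    moreover have "square_integrable M (\<lambda>_. 1)" by (simp add: square_integrable_def)
    \<comment> \<open>Pairing the convergent series with the constant 1 exhibits the mean as a sum
      of zeros.\<close>
    ultimately have "(\<lambda>l::nat. 0) sums (\<integral>\<omega>. sifting_convolution M T H \<omega> x \<partial>M)"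
      using L2_sums_imp_sums_integral_mult[OF conv[of x], of "\<lambda>_. 1"] by simp
    then show ?thesis using sums_zero sums_unique2 by blast
  qed
  have conv_cov: "(\<lambda>l. complex_of_real (C l) *
       (\<Sum>m=-int l..int l. complex_of_real ((cmod (h l m))\<^sup>2) * Ylm l m x1 * cnj (Ylm l m x2)))
     sums field_cov M (sifting_convolution M T H) x1 x2" for x1 x2
  proof -
    \<comment> \<open>Regrouping moves all deterministic factors into the weights of
      \<open>integral_coeff_block_mult_cnj\<close>.\<close>
    have block: "(\<Sum>m=-int l..int l. sifting_coeff T h l m \<omega> * Ylm l m x)
        = (\<Sum>m=-int l..int l. (cnj (h l m) * Ylm l m x) * coeff l m \<omega>)" for l \<omega> x
      by (simp add: sifting_coeff_def mult_ac)
    \<comment> \<open>Terms of different degrees are orthogonal in L^2 of \<open>M\<close>, so the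
      covariance is a single sum over degrees.\<close>
    have "(\<lambda>l. \<integral>\<omega>. (\<Sum>m=-int l..int l. sifting_coeff T h l m \<omega> * Ylm l m x1) *
            cnj (\<Sum>m=-int l..int l. sifting_coeff T h l m \<omega> * Ylm l m x2) \<partial>M)
        sums (\<integral>\<omega>. sifting_convolution M T H \<omega> x1 * cnj (sifting_convolution M T H \<omega> x2) \<partial>M)"
      by (rule L2_sums_imp_sums_integral_mult_cnj[OF conv conv])
         (simp only: block integral_coeff_block_mult_cnj if_False)
    then show ?thesis
      unfolding block integral_coeff_block_mult_cnj field_cov_def complex_norm_square
      by (simp only: if_True simp_thms complex_cnj_mult complex_cnj_cnj mult_ac)
  qed
  show ?thesis
    using L2_sums_translation conv sq mean cov conv_mean conv_cov by blast
qed

end
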